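(* For every $\delta>0$ there exist smooth divergence-free vector fields $u_0,b_0$ on $\mathbb{T}^3$, a time $T$ with $0<T<\delta$, and a solution $(u,b,p)$ on $\mathbb{T}^3\times[0,T]$ of the incompressible magneto-hydrodynamic system $$u_t-\Delta u+u\cdot\nabla u-b\cdot\nabla b+\nabla p=0,\qquad b_t-\Delta b+u\cdot\nabla b-b\cdot\nabla u=0,\qquad \nabla\cdot u=0,\quad \nabla\cdot b=0,$$ with $u(\cdot,0)=u_0$, $b(\cdot,0)=b_0$, such that $$\|u(0)\|_{\dot B^{-1,\infty}_\infty}\lesssim\delta,\qquad \|b(0)\|_{\dot B^{-1,\infty}_\infty}\lesssim\delta,\qquad \|b(T)\|_{\dot B^{-1,\infty}_\infty}\gtrsim\frac1\delta,$$ while for all $0<t<T$ $$\|u(t)\|_{B^{-1,\infty}_\infty}\lesssim\delta .$$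
   Context: $\mathbb{T}^3=\mathbb{R}^3/(2\pi\mathbb{Z})^3$; functions on $\mathbb{T}^3$ are identified with periodic functions on $\mathbb{R}^3$. $u$ is the velocity, $b$ the magnetic field (both $\mathbb{R}^3$-valued), $p$ the scalar pressure. $e^{t\Delta}$ is the heat semigroup. The homogeneous Besov norm is $\|f\|_{\dot B^{-1,\infty}_\infty}=\sup_{t>0}t^{1/2}\|e^{t\Delta}f\|_{L^\infty}$, and the inhomogeneous one is $\|f\|_{B^{-1,\infty}_\infty}=\sup_{0<t<1}t^{1/2}\|e^{t\Delta}f\|_{L^\infty}$. $A\lesssim B$ means $A\le CB$ for an absolute constant $C>0$ (independent of $\delta$), and $A\gtrsim B$ means $B\lesssim A$. *)

theory Defs
  imports "HOL-Analysis.Analysis" "HOL-Probability.Essential_Supremum"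
begin

section \<open>Calculus on the torus\<close>

text \<open>Functions on \<open>(\<real>/2\<pi>\<int>)\<^sup>3\<close> are the functions on \<open>real ^ 3\<close> with the following property.\<close>

definition periodic :: "(real ^ 3 \<Rightarrow> 'a) \<Rightarrow> bool" where
  "periodic f \<longleftrightarrow> (\<forall>x i. f (x + axis i (2 * pi)) = f x)"

definition partial :: "3 \<Rightarrow> (real ^ 3 \<Rightarrow> 'a::real_normed_vector) \<Rightarrow> real ^ 3 \<Rightarrow> 'a" where
  "partial i f x = frechet_derivative f (at x) (axis i 1)"

primrec Ck :: "nat \<Rightarrow> (real ^ 3 \<Rightarrow> 'a::real_normed_vector) \<Rightarrow> bool" where
  "Ck 0 f \<longleftrightarrow> continuous_on UNIV f"
| "Ck (Suc n) f \<longleftrightarrow> (\<forall>x. f differentiable at x) \<and> (\<forall>i. Ck n (partial i f))"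

definition smooth :: "(real ^ 3 \<Rightarrow> 'a::real_normed_vector) \<Rightarrow> bool" where
  "smooth f \<longleftrightarrow> (\<forall>n. Ck n f)"

definition divergence :: "(real ^ 3 \<Rightarrow> real ^ 3) \<Rightarrow> real ^ 3 \<Rightarrow> real" where
  "divergence v x = (\<Sum>i\<in>UNIV. partial i v x $ i)"

definition gradient :: "(real ^ 3 \<Rightarrow> real) \<Rightarrow> real ^ 3 \<Rightarrow> real ^ 3" where
  "gradient q x = (\<chi> i. partial i q x)"

definition laplacian :: "(real ^ 3 \<Rightarrow> 'a::real_normed_vector) \<Rightarrow> real ^ 3 \<Rightarrow> 'a" where
  "laplacian f x = (\<Sum>i\<in>UNIV. partial i (partial i f) x)"

definition advect :: "(real ^ 3 \<Rightarrow> real ^ 3) \<Rightarrow> (real ^ 3 \<Rightarrow> real ^ 3) \<Rightarrow> real ^ 3 \<Rightarrow> real ^ 3" where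
  "advect v w x = (\<Sum>i\<in>UNIV. v x $ i *\<^sub>R partial i w x)"

section \<open>Heat semigroup and Besov norms\<close>

text \<open>For periodic \<open>f\<close>, convolution with the Gaussian on the whole space agrees with
  convolution on the torus with the periodised kernel.\<close>

definition heat_kernel :: "real \<Rightarrow> real ^ 3 \<Rightarrow> real" where
  "heat_kernel t y = exp (- (norm y)\<^sup>2 / (4 * t)) / (4 * pi * t) powr (3 / 2)"

definition heat :: "real \<Rightarrow> (real ^ 3 \<Rightarrow> real ^ 3) \<Rightarrow> real ^ 3 \<Rightarrow> real ^ 3" where
  "heat t f x = (LINT y|lborel. heat_kernel t y *\<^sub>R f (x - y))"

text \<open>The norms take values in \<open>ennreal\<close>, with value \<open>\<infinity>\<close> outside the respective space.\<close>

definition Linf_norm :: "(real ^ 3 \<Rightarrow> real ^ 3) \<Rightarrow> ennreal" where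
  "Linf_norm f = esssup lborel (\<lambda>x. ennreal (norm (f x)))"

definition besov_hom_norm :: "(real ^ 3 \<Rightarrow> real ^ 3) \<Rightarrow> ennreal" where
  "besov_hom_norm f = (SUP t\<in>{0<..}. ennreal (sqrt t) * Linf_norm (heat t f))"

definition besov_norm :: "(real ^ 3 \<Rightarrow> real ^ 3) \<Rightarrow> ennreal" where
  "besov_norm f = (SUP t\<in>{0<..<1}. ennreal (sqrt t) * Linf_norm (heat t f))"

section \<open>Classical solutions of the MHD system\<close>

definition cont_spacetime :: "real \<Rightarrow> (real \<Rightarrow> real ^ 3 \<Rightarrow> 'a::topological_space) \<Rightarrow> bool" where
  "cont_spacetime T f \<longleftrightarrow> continuous_on ({0..T} \<times> UNIV) (\<lambda>(t, x). f t x)"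

text \<open>At the endpoints of \<open>[0,T]\<close> this is the one-sided derivative.\<close>

definition time_deriv :: "real \<Rightarrow> (real \<Rightarrow> real ^ 3 \<Rightarrow> real ^ 3) \<Rightarrow> real \<Rightarrow> real ^ 3 \<Rightarrow> real ^ 3" where
  "time_deriv T v t x = vector_derivative (\<lambda>s. v s x) (at t within {0..T})"

text \<open>Periodic fields of class \<open>C\<^sup>2\<close> in space and \<open>C\<^sup>1\<close> in time on \<open>[0,T]\<close>, all these
  derivatives being jointly continuous up to the endpoints.\<close>

definition classical_field :: "real \<Rightarrow> (real \<Rightarrow> real ^ 3 \<Rightarrow> real ^ 3) \<Rightarrow> bool" where
  "classical_field T v \<longleftrightarrow>
     (\<forall>t\<in>{0..T}. periodic (v t) \<and> Ck 2 (v t)) \<and>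
     (\<forall>t\<in>{0..T}. \<forall>x. (\<lambda>s. v s x) differentiable (at t within {0..T})) \<and>
     cont_spacetime T v \<and>
     cont_spacetime T (time_deriv T v) \<and>
     (\<forall>i. cont_spacetime T (\<lambda>t. partial i (v t))) \<and>
     (\<forall>i j. cont_spacetime T (\<lambda>t. partial i (partial j (v t))))"

definition classical_pressure :: "real \<Rightarrow> (real \<Rightarrow> real ^ 3 \<Rightarrow> real) \<Rightarrow> bool" where
  "classical_pressure T p \<longleftrightarrow>
     (\<forall>t\<in>{0..T}. periodic (p t) \<and> Ck 1 (p t)) \<and>
     cont_spacetime T p \<and>
     (\<forall>i. cont_spacetime T (\<lambda>t. partial i (p t)))"

definition mhd_solution ::
  "real \<Rightarrow> (real \<Rightarrow> real ^ 3 \<Rightarrow> real ^ 3) \<Rightarrow> (real \<Rightarrow> real ^ 3 \<Rightarrow> real ^ 3) \<Rightarrow> (real \<Rightarrow> real ^ 3 \<Rightarrow> real) \<Rightarrow> bool"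
where
  "mhd_solution T u b p \<longleftrightarrow>
     classical_field T u \<and> classical_field T b \<and> classical_pressure T p \<and>
     (\<forall>t\<in>{0..T}. \<forall>x.
        time_deriv T u t x - laplacian (u t) x + advect (u t) (u t) x
          - advect (b t) (b t) x + gradient (p t) x = 0 \<and>
        time_deriv T b t x - laplacian (b t) x + advect (u t) (b t) x
          - advect (b t) (u t) x = 0 \<and>
        divergence (u t) x = 0 \<and> divergence (b t) x = 0)"

end

theory Submission
  imports Defs "HOL-Probability.Probability"
begin

text \<open>
  Take \<open>u = (0, U(x\<^sub>1, t), 0)\<close> with \<open>U\<close> a solution of the heat equation and
  \<open>b = (0, 0, \<beta>(x\<^sub>1, x\<^sub>2, t))\<close>. Then \<open>u \<cdot> \<nabla>u = b \<cdot> \<nabla>b = b \<cdot> \<nabla>u = 0\<close>, so the system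
  holds with \<open>p = 0\<close> as soon as \<open>\<beta>\<close> is a passive scalar, \<open>\<beta>\<^sub>t = \<Delta>\<beta> - U \<partial>\<^sub>2\<beta>\<close>; in particular
  \<open>u\<close> never feels \<open>b\<close> and stays small.

  Both \<open>U\<close> and \<open>\<beta>\<close> start from lacunary sums \<open>\<Sum>\<^sub>s \<epsilon> k\<^sub>s cos (k\<^sub>s x\<^sub>1)\<close>, \<open>k\<^sub>s = L 2\<^sup>s\<close>, \<open>s < r\<close>
  (for \<open>\<beta>\<close> times \<open>cos x\<^sub>2\<close>), whose Besov norm is \<open>O(\<epsilon>)\<close> uniformly in \<open>r\<close>. In the first Picard
  iterate each frequency resonates with its negative and contributes about \<open>\<epsilon>\<^sup>2/4\<close> to the mode
  \<open>sin x\<^sub>2\<close>, whence a low mode of size \<open>r \<epsilon>\<^sup>2\<close>, which exceeds \<open>1/\<epsilon>\<close> for \<open>r \<sim> \<epsilon>\<^sup>-\<^sup>3\<close>. The further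
  iterates are smaller by powers of \<open>\<integral> \<parallel>U\<parallel>\<^sub>\<infinity> dt \<le> \<epsilon> r / L\<close> and are negligible once \<open>L\<close> is large.
\<close>

section \<open>The heat semigroup on plane waves\<close>

text \<open>Fubini for products of one-variable functions: \<open>lborel\<close> on a Euclidean
  space is the image of a product of one-dimensional Lebesgue measures.\<close>

lemma
  fixes f :: "'a::euclidean_space \<Rightarrow> real \<Rightarrow> complex"
  assumes f: "\<And>b. b \<in> Basis \<Longrightarrow> integrable lborel (f b)"
  shows integrable_lborel_prod_Basis: "integrable lborel (\<lambda>x::'a. \<Prod>b\<in>Basis. f b (x \<bullet> b))"
    and integral_lborel_prod_Basis:
      "(LINT x|lborel. (\<Prod>b\<in>Basis. f b (x \<bullet> b))) = (\<Prod>b\<in>Basis. (LINT y|lborel. f b y))"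
proof -
  interpret product_sigma_finite "\<lambda>b::'a. lborel :: real measure" ..
  have [measurable]: "f b \<in> borel_measurable borel" if "b \<in> Basis" for b
    using borel_measurable_integrable[OF f[OF that]] by simp
  have eq: "(\<Prod>b\<in>Basis. f b ((\<Sum>c\<in>Basis. x c *\<^sub>R c) \<bullet> b)) = (\<Prod>b\<in>Basis. f b (x b))" for x :: "'a \<Rightarrow> real"
    by (intro prod.cong refl arg_cong[where f="f _"]) simp
  show "integrable lborel (\<lambda>x::'a. \<Prod>b\<in>Basis. f b (x \<bullet> b))"
    by (subst lborel_eq, subst integrable_distr_eq)
      (simp_all add: eq product_integrable_prod f)
  show "(LINT x|lborel. (\<Prod>b\<in>Basis. f b (x \<bullet> b))) = (\<Prod>b\<in>Basis. (LINT y|lborel. f b y))"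
    by (subst lborel_eq, subst integral_distr)
      (simp_all add: eq product_integral_prod f)
qed

text \<open>The integrand is a normal density of variance \<open>2 * t\<close> times a character.
  Rescaling by \<open>\<sigma>\<close> turns the integral into the characteristic function of the
  standard normal law at \<open>a * \<sigma>\<close>.\<close>

lemma
  fixes a t :: real
  assumes t: "t > 0"
  defines "g \<equiv> \<lambda>y. complex_of_real (exp (- y\<^sup>2 / (4 * t)) / sqrt (4 * pi * t)) * cis (a * y)"
  shows integrable_gaussian_cis: "integrable lborel g"
    and integral_gaussian_cis: "(LINT y|lborel. g y) = exp (- t * a\<^sup>2)"
proof -
  define \<sigma> where "\<sigma> = sqrt (2 * t)"
  have \<sigma>: "\<sigma> > 0" "\<sigma>\<^sup>2 = 2 * t" using t by (auto simp: \<sigma>_def)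
  have g_eq: "g y = normal_density 0 \<sigma> y *\<^sub>R cis (a * y)" for y
    unfolding g_def normal_density_def \<sigma> by (simp add: scaleR_conv_of_real)
  show int: "integrable lborel g"
    unfolding g_eq
    by (rule Bochner_Integration.integrable_bound[OF integrable_normal_density[OF \<sigma>(1), of 0]])
      (auto simp: cis_conv_exp intro!: borel_measurable_times borel_measurable_continuous_onI continuous_intros)
  have "(LINT y|lborel. g y) = \<sigma> *\<^sub>R (LINT y|lborel. g (0 + \<sigma> * y))"
    using lborel_integral_real_affine[of \<sigma> g 0] \<sigma>(1) by simp
  also have "\<dots> = (LINT y|lborel. \<sigma> *\<^sub>R g (0 + \<sigma> * y))" by simp
  also have "\<dots> = (LINT y|lborel. std_normal_density y *\<^sub>R iexp (a * \<sigma> * y))"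
    using \<sigma>(1) by (intro Bochner_Integration.integral_cong refl)
      (simp add: g_eq normal_density_def real_sqrt_mult power_mult_distrib cis_conv_exp
        scaleR_conv_of_real field_simps)
  also have "\<dots> = char std_normal_distribution (a * \<sigma>)"
    unfolding char_def by (subst integral_density) (auto simp: normal_density_nonneg)
  also have "\<dots> = exp (- t * a\<^sup>2)"
    unfolding char_std_normal_distribution
    by (rule arg_cong[where f=complex_of_real]) (simp add: power_mult_distrib \<sigma> mult.commute)
  finally show "(LINT y|lborel. g y) = exp (- t * a\<^sup>2)" .
qed

lemma Basis_vec3: "(Basis :: (real ^ 3) set) = (\<lambda>i. axis i 1) ` UNIV"
  by (auto simp: Basis_vec_def)

lemma prod_Basis_vec3: "(\<Prod>b\<in>(Basis :: (real ^ 3) set). F b) = (\<Prod>i\<in>UNIV. F (axis i 1))"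
  unfolding Basis_vec3 by (subst prod.reindex) (auto simp: inj_on_def axis_eq_axis)

lemma heat_kernel_prod:
  assumes "t > 0"
  shows "heat_kernel t y = (\<Prod>i\<in>UNIV. exp (- (y $ i)\<^sup>2 / (4 * t)) / sqrt (4 * pi * t))"
proof -
  have "(4 * pi * t) powr (3 / 2) = ((4 * pi * t) powr (1/2)) powr 3"
    by (simp add: powr_powr)
  also have "\<dots> = sqrt (4 * pi * t) ^ 3"
    using assms by (simp add: powr_half_sqrt)
  finally have 1: "(4 * pi * t) powr (3 / 2) = sqrt (4 * pi * t) ^ 3" .
  have "exp (- (norm y)\<^sup>2 / (4 * t)) = (\<Prod>i\<in>UNIV. exp (- (y $ i)\<^sup>2 / (4 * t)))"
    by (simp add: exp_sum[symmetric] norm_vec_def L2_set_def sum_nonneg sum_divide_distrib sum_negf)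
  then show ?thesis
    unfolding heat_kernel_def 1 by (simp add: prod_dividef)
qed

lemma cis_sum: "finite A \<Longrightarrow> cis (\<Sum>a\<in>A. f a) = (\<Prod>a\<in>A. cis (f a))"
  by (induction rule: finite_induct) (auto simp: cis_mult[symmetric])

text \<open>This makes plane waves eigenfunctions of the heat semigroup. Kernel and wave both factor
  over the coordinates, which leaves three one-dimensional Gaussian integrals.\<close>

lemma
  fixes \<xi> :: "real ^ 3"
  assumes t: "t > 0"
  shows integrable_heat_kernel_cis: "integrable lborel (\<lambda>y. complex_of_real (heat_kernel t y) * cis (\<xi> \<bullet> y))"
    and integral_heat_kernel_cis: "(LINT y|lborel. complex_of_real (heat_kernel t y) * cis (\<xi> \<bullet> y)) = exp (- t * (norm \<xi>)\<^sup>2)"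
proof -
  define f where "f b y = complex_of_real (exp (- y\<^sup>2 / (4 * t)) / sqrt (4 * pi * t)) * cis ((\<xi> \<bullet> b) * y)"
    for b :: "real ^ 3" and y
  have eq: "complex_of_real (heat_kernel t y) * cis (\<xi> \<bullet> y) = (\<Prod>b\<in>Basis. f b (y \<bullet> b))" for y
    by (simp add: prod_Basis_vec3 f_def inner_axis heat_kernel_prod[OF t] inner_vec_def[of \<xi> y] cis_sum
      flip: prod.distrib)
  have int: "integrable lborel (f b)" for b
    unfolding f_def by (rule integrable_gaussian_cis[OF t])
  show "integrable lborel (\<lambda>y. complex_of_real (heat_kernel t y) * cis (\<xi> \<bullet> y))"
    unfolding eq by (rule integrable_lborel_prod_Basis[OF int])
  have "(norm \<xi>)\<^sup>2 = (\<Sum>i\<in>UNIV. (\<xi> $ i)\<^sup>2)"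
    by (simp add: norm_vec_def L2_set_def sum_nonneg)
  moreover have "(LINT y|lborel. f b y) = exp (- t * (\<xi> \<bullet> b)\<^sup>2)" for b
    unfolding f_def by (rule integral_gaussian_cis[OF t])
  ultimately show "(LINT y|lborel. complex_of_real (heat_kernel t y) * cis (\<xi> \<bullet> y)) = exp (- t * (norm \<xi>)\<^sup>2)"
    unfolding eq integral_lborel_prod_Basis[OF int]
    by (simp add: prod_Basis_vec3 inner_axis exp_sum[symmetric] sum_distrib_left sum_negf flip: of_real_prod)
qed

lemma
  assumes "t > 0"
  shows integrable_heat_kernel: "integrable lborel (heat_kernel t)"
    and integral_heat_kernel: "(LINT y|lborel. heat_kernel t y) = 1"
proof -
  have *: "integrable lborel (\<lambda>y. complex_of_real (heat_kernel t y))"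
    and **: "(LINT y|lborel. complex_of_real (heat_kernel t y)) = 1"
    using integrable_heat_kernel_cis[OF assms, of 0] integral_heat_kernel_cis[OF assms, of 0] by simp_all
  show "integrable lborel (heat_kernel t)"
    using integrable_Re[OF *] by simp
  show "(LINT y|lborel. heat_kernel t y) = 1"
    using integral_complex_of_real[of lborel "heat_kernel t"] ** by simp
qed

section \<open>The heat semigroup on scalar functions\<close>

lemma heat_kernel_nonneg: "heat_kernel t y \<ge> 0"
  by (simp add: heat_kernel_def)

text \<open>Every field of the construction is a scalar function times a fixed unit vector, so the
  semigroup is studied on the scalar factor.\<close>

definition scalar_heat :: "real \<Rightarrow> (real ^ 3 \<Rightarrow> real) \<Rightarrow> real ^ 3 \<Rightarrow> real" where
  "scalar_heat t f x = (LINT y|lborel. heat_kernel t y * f (x - y))"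

lemma integrable_scalar_heat:
  assumes t: "t > 0" and f: "continuous_on UNIV f" "\<And>x. \<bar>f x\<bar> \<le> B"
  shows "integrable lborel (\<lambda>y. heat_kernel t y * f (x - y))"
proof (rule Bochner_Integration.integrable_bound[OF integrable_mult_right[OF integrable_heat_kernel[OF t], of B]])
  have "continuous_on UNIV (\<lambda>y. f (x - y))"
    by (rule continuous_on_compose2[OF f(1)]) (auto intro: continuous_intros)
  then show "(\<lambda>y. heat_kernel t y * f (x - y)) \<in> borel_measurable lborel"
    using borel_measurable_integrable[OF integrable_heat_kernel[OF t]]
    by (intro borel_measurable_times) (auto intro: borel_measurable_continuous_onI)
  show "AE y in lborel. norm (heat_kernel t y * f (x - y)) \<le> norm (B * heat_kernel t y)"
  proof (rule AE_I2)
    fix y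
    have "\<bar>f (x - y)\<bar> \<le> \<bar>B\<bar>" using f(2)[of "x - y"] by linarith
    then show "norm (heat_kernel t y * f (x - y)) \<le> norm (B * heat_kernel t y)"
      by (simp add: abs_mult mult.commute[of "\<bar>B\<bar>"] mult_left_mono)
  qed
qed

text \<open>The kernel is nonnegative and has mass one. The bound serves to control the higher
  Picard iterates after heating.\<close>

lemma abs_scalar_heat_le:
  assumes t: "t > 0" and f: "continuous_on UNIV f" "\<And>x. \<bar>f x\<bar> \<le> B"
  shows "\<bar>scalar_heat t f x\<bar> \<le> B"
proof -
  have "norm (scalar_heat t f x) \<le> (LINT y|lborel. B * heat_kernel t y)"
    unfolding scalar_heat_def
  proof (rule Bochner_Integration.integral_norm_bound_integral)
    show "norm (heat_kernel t y * f (x - y)) \<le> B * heat_kernel t y" for y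
      using f(2)[of "x - y"] heat_kernel_nonneg[of t y]
      by (simp add: abs_mult mult.commute[of B] mult_left_mono)
  qed (use integrable_scalar_heat[OF assms] integrable_heat_kernel[OF t] in auto)
  then show ?thesis using integral_heat_kernel[OF t] by simp
qed

lemma scalar_heat_wave:
  fixes \<xi> :: "'w \<Rightarrow> real ^ 3" and c :: "'w \<Rightarrow> complex"
  assumes t: "t > 0"
  shows "scalar_heat t (\<lambda>x. Re (\<Sum>w\<in>A. c w * cis (\<xi> w \<bullet> x))) x =
    Re (\<Sum>w\<in>A. exp (- t * (norm (\<xi> w))\<^sup>2) * c w * cis (\<xi> w \<bullet> x))"
proof -
  have eq: "complex_of_real (heat_kernel t y) * (\<Sum>w\<in>A. c w * cis (\<xi> w \<bullet> (x - y))) =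
      (\<Sum>w\<in>A. (c w * cis (\<xi> w \<bullet> x)) * (complex_of_real (heat_kernel t y) * cis ((- \<xi> w) \<bullet> y)))" for y
    by (simp add: sum_distrib_left inner_diff_right cis_mult[symmetric] mult_ac flip: cis_divide cis_inverse add: divide_inverse)
  have int: "integrable lborel (\<lambda>y. c w * cis (\<xi> w \<bullet> x) * (complex_of_real (heat_kernel t y) * cis ((- \<xi> w) \<bullet> y)))" for w
    by (intro integrable_mult_right integrable_heat_kernel_cis[OF t])
  have "scalar_heat t (\<lambda>x. Re (\<Sum>w\<in>A. c w * cis (\<xi> w \<bullet> x))) x =
     (LINT y|lborel. Re (complex_of_real (heat_kernel t y) * (\<Sum>w\<in>A. c w * cis (\<xi> w \<bullet> (x - y)))))"
    unfolding scalar_heat_def by (intro Bochner_Integration.integral_cong refl) simp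
  also have "\<dots> = Re (LINT y|lborel. (\<Sum>w\<in>A. (c w * cis (\<xi> w \<bullet> x)) * (complex_of_real (heat_kernel t y) * cis ((- \<xi> w) \<bullet> y))))"
    unfolding eq by (intro integral_Re Bochner_Integration.integrable_sum int)
  also have "(LINT y|lborel. (\<Sum>w\<in>A. (c w * cis (\<xi> w \<bullet> x)) * (complex_of_real (heat_kernel t y) * cis ((- \<xi> w) \<bullet> y)))) =
     (\<Sum>w\<in>A. (c w * cis (\<xi> w \<bullet> x)) * exp (- t * (norm (\<xi> w))\<^sup>2))"
    by (subst Bochner_Integration.integral_sum[OF int]) (simp only: integral_mult_right_zero integral_heat_kernel_cis[OF t] norm_minus_cancel)
  finally show ?thesis by (simp add: mult_ac)
qed

lemma scalar_heat_add:
  assumes t: "t > 0" and f: "continuous_on UNIV f" "\<And>x. \<bar>f x\<bar> \<le> B"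
    and g: "continuous_on UNIV g" "\<And>x. \<bar>g x\<bar> \<le> B'"
  shows "scalar_heat t (\<lambda>x. f x + g x) x = scalar_heat t f x + scalar_heat t g x"
  unfolding scalar_heat_def
  by (simp add: distrib_left Bochner_Integration.integral_add[OF integrable_scalar_heat[OF t f] integrable_scalar_heat[OF t g]])

text \<open>Scaling by \<open>e\<close> has a bounded left inverse, the inner product with
  \<open>e\<close> divided by \<open>e \<bullet> e\<close>. So the two integrands are integrable
  together, and otherwise both integrals take the default value 0.\<close>

lemma heat_scaleR: "e \<noteq> 0 \<Longrightarrow> heat t (\<lambda>x. f x *\<^sub>R e) x = scalar_heat t f x *\<^sub>R e"
  unfolding heat_def scalar_heat_def scaleR_scaleR
  by (rule integral_bounded_linear'[OF bounded_linear_scaleR_left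
        bounded_linear_compose[OF bounded_linear_divide[of "e \<bullet> e"] bounded_linear_inner_left[of e]]])
    simp

text \<open>\<open>esssup\<close> ignores null sets, so a lower bound has to hold on a set of
  positive measure; a nonempty open set is one.\<close>

lemma Linf_norm_heat_ge:
  assumes e: "norm e = 1" and O: "open O'" "O' \<noteq> {}" and c: "\<And>x. x \<in> O' \<Longrightarrow> c \<le> \<bar>scalar_heat t f x\<bar>"
  shows "ennreal c \<le> Linf_norm (heat t (\<lambda>x. f x *\<^sub>R e))"
proof (rule ccontr)
  assume "\<not> ?thesis"
  then have less: "Linf_norm (heat t (\<lambda>x. f x *\<^sub>R e)) < ennreal c" by simp
  have "e \<noteq> 0" using e by auto
  have "AE x in lborel. ennreal \<bar>scalar_heat t f x\<bar> \<le> Linf_norm (heat t (\<lambda>x. f x *\<^sub>R e))"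
    using esssup_AE[where M=lborel and f="\<lambda>x. ennreal (norm (heat t (\<lambda>x. f x *\<^sub>R e) x))"]
    by (simp add: Linf_norm_def heat_scaleR[OF \<open>e \<noteq> 0\<close>] e)
  then have "AE x in lborel. x \<notin> O'"
  proof (rule eventually_mono)
    fix x assume "ennreal \<bar>scalar_heat t f x\<bar> \<le> Linf_norm (heat t (\<lambda>x. f x *\<^sub>R e))"
    then have "ennreal \<bar>scalar_heat t f x\<bar> < ennreal c" using less by order
    then show "x \<notin> O'" using c by (metis ennreal_leI linorder_not_le)
  qed
  then have "O' \<in> null_sets lborel"
    using O(1) by (subst (asm) AE_iff_null) (auto simp: )
  then have "negligible O'" by (simp add: negligible_iff_null_sets null_sets_completionI)
  with O show False using open_not_negligible by blast
qed

text \<open>Continuity supplies the measurability that an upper bound on \<open>esssup\<close>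
  requires.\<close>

lemma Linf_norm_heat_le:
  assumes e: "norm e = 1" and c: "continuous_on UNIV (scalar_heat t f)" "\<And>x. \<bar>scalar_heat t f x\<bar> \<le> c"
  shows "Linf_norm (heat t (\<lambda>x. f x *\<^sub>R e)) \<le> ennreal c"
proof -
  have "e \<noteq> 0" using e by auto
  have "(\<lambda>x. ennreal \<bar>scalar_heat t f x\<bar>) \<in> borel_measurable lborel"
    using borel_measurable_continuous_onI[OF c(1)] by measurable
  then show ?thesis
    unfolding Linf_norm_def heat_scaleR[OF \<open>e \<noteq> 0\<close>] using c(2)
    by (intro esssup_I) (auto simp: e intro: ennreal_leI)
qed

section \<open>Series of plane waves\<close>

text \<open>Weierstrass test for derivatives: the tails of \<open>M\<close> make the differentiated
  series converge uniformly. Working within a convex \<open>S\<close> covers both space derivatives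
  and one-sided time derivatives on \<open>{0..T}\<close>.\<close>

lemma sums_has_derivative:
  fixes f :: "nat \<Rightarrow> 'a::real_normed_vector \<Rightarrow> 'b::banach"
  assumes S: "convex S" "x \<in> S"
    and f: "\<And>n x. x \<in> S \<Longrightarrow> (f n has_derivative f' n x) (at x within S)"
    and bound: "\<And>n x (h::'a). x \<in> S \<Longrightarrow> norm (f' n x h) \<le> M n * norm h" and M: "summable M"
    and sums: "\<And>x. x \<in> S \<Longrightarrow> (\<lambda>n. f n x) sums g x"
  shows "(g has_derivative (\<lambda>h. \<Sum>n. f' n x h)) (at x within S)"
proof -
  have "\<exists>g. \<forall>x\<in>S. (\<lambda>n. f n x) sums (g x) \<and> (g has_derivative (\<lambda>h. \<Sum>n. f' n x h)) (at x within S)"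
  proof (rule has_derivative_series[OF S(1) f _ S(2) sums[OF S(2)]])
    fix e :: real assume "e > 0"
    from suminf_exist_split[OF this M] obtain N where N: "\<And>n. n \<ge> N \<Longrightarrow> norm (\<Sum>i. M (i + n)) < e"
      by blast
    show "\<forall>\<^sub>F n in sequentially. \<forall>x\<in>S. \<forall>h. norm ((\<Sum>i<n. f' i x h) - (\<Sum>n. f' n x h)) \<le> e * norm h"
      using eventually_ge_at_top[of N]
    proof (eventually_elim, intro ballI allI)
      fix n x and h :: 'a assume n: "n \<ge> N" and x: "x \<in> S"
      have sm: "summable (\<lambda>n. M n * norm h)" using M by (rule summable_mult2)
      have s: "summable (\<lambda>n. f' n x h)"
        by (rule summable_comparison_test[OF _ sm]) (use bound[OF x] in auto)
      have sM: "summable (\<lambda>i. M (i + n))" using M by simp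
      have "norm ((\<Sum>i<n. f' i x h) - (\<Sum>n. f' n x h)) = norm (\<Sum>i. f' (i + n) x h)"
        by (subst suminf_split_initial_segment[OF s, of n]) simp
      also have "\<dots> \<le> (\<Sum>i. M (i + n) * norm h)"
        by (rule norm_suminf_le[OF bound[OF x] summable_mult2[OF sM]])
      also have "\<dots> = (\<Sum>i. M (i + n)) * norm h"
        using suminf_mult2[OF sM] by simp
      also have "\<dots> \<le> e * norm h"
        using N[OF n] by (intro mult_right_mono) auto
      finally show "norm ((\<Sum>i<n. f' i x h) - (\<Sum>n. f' n x h)) \<le> e * norm h" .
    qed
  qed
  \<comment> \<open>The theorem on series yields some limit function; uniqueness of limits
    identifies it with \<open>g\<close> on \<open>S\<close>.\<close>
  then obtain g' where g': "\<And>x. x \<in> S \<Longrightarrow> (\<lambda>n. f n x) sums (g' x)"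
      "(g' has_derivative (\<lambda>h. \<Sum>n. f' n x h)) (at x within S)"
    using S(2) by blast
  have "g y = g' y" if "y \<in> S" for y
    using sums_unique2[OF sums[OF that] g'(1)[OF that]] .
  then show ?thesis
    by (rule has_derivative_transform[OF S(2) _ g'(2)])
qed

section \<open>Differential operators on fields of fixed direction\<close>

lemma partial_eq: "(f has_derivative f') (at x) \<Longrightarrow> partial i f x = f' (axis i 1)"
  unfolding partial_def by (drule frechet_derivative_at) simp

lemma partial_scaleR_const:
  assumes "f differentiable at x"
  shows "partial i (\<lambda>x. f x *\<^sub>R e) x = partial i f x *\<^sub>R e"
  using partial_eq[OF has_derivative_scaleR_left[OF assms[unfolded frechet_derivative_works]]]
  by (simp add: partial_def[of i f])

lemma Ck_scaleR_const: "Ck n f \<Longrightarrow> Ck n (\<lambda>x. f x *\<^sub>R e)"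
proof (induction n arbitrary: f)
  case (Suc n)
  then have "partial i (\<lambda>x. f x *\<^sub>R e) = (\<lambda>x. partial i f x *\<^sub>R e)" for i
    by (intro ext partial_scaleR_const) simp
  with Suc show ?case by (auto intro!: derivative_intros simp: differentiable_scaleR)
qed (auto intro: continuous_intros)

lemma smooth_scaleR_const: "smooth f \<Longrightarrow> smooth (\<lambda>x. f x *\<^sub>R e)"
  unfolding smooth_def by (blast intro: Ck_scaleR_const)

lemma divergence_scaleR_axis:
  assumes "f differentiable at x"
  shows "divergence (\<lambda>x. f x *\<^sub>R axis k 1) x = partial k f x"
proof -
  have "(partial i f x *\<^sub>R axis k 1 :: real ^ 3) $ i = (if i = k then partial i f x else 0)" for i
    by (simp add: axis_def)
  then show ?thesis unfolding divergence_def partial_scaleR_const[OF assms] by simp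
qed

text \<open>A field along one axis differentiates in that direction only. This is what makes most
  nonlinear terms of the system vanish.\<close>

lemma advect_scaleR_axis: "advect (\<lambda>x. f x *\<^sub>R axis k 1) w x = f x *\<^sub>R partial k w x"
proof -
  have "(f x *\<^sub>R axis k 1 :: real ^ 3) $ i *\<^sub>R partial i w x = (if i = k then f x *\<^sub>R partial i w x else 0)" for i
    by (simp add: axis_def)
  then show ?thesis unfolding advect_def by simp
qed

section \<open>Finite sums of plane waves\<close>

lemma Re_cis_sum_has_derivative:
  fixes \<xi> :: "'w \<Rightarrow> 'a::real_inner" and c :: "'w \<Rightarrow> complex"
  shows "((\<lambda>x. Re (\<Sum>w\<in>A. c w * cis (\<xi> w \<bullet> x))) has_derivative
    (\<lambda>h. Re (\<Sum>w\<in>A. \<i> * (\<xi> w \<bullet> h) * c w * cis (\<xi> w \<bullet> x)))) (at x within S)"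
proof -
  have 1: "((\<lambda>x. exp (\<i> * complex_of_real (\<xi> w \<bullet> x))) has_derivative
      (\<lambda>h. exp (\<i> * complex_of_real (\<xi> w \<bullet> x)) * (\<i> * complex_of_real (\<xi> w \<bullet> h)))) (at x within S)" for w
    by (rule has_derivative_compose[OF _ DERIV_exp[THEN has_field_derivative_imp_has_derivative]])
      (auto intro!: derivative_eq_intros)
  have "((\<lambda>x. Re (\<Sum>w\<in>A. c w * exp (\<i> * complex_of_real (\<xi> w \<bullet> x)))) has_derivative
    (\<lambda>h. Re (\<Sum>w\<in>A. c w * (exp (\<i> * complex_of_real (\<xi> w \<bullet> x)) * (\<i> * complex_of_real (\<xi> w \<bullet> h)))))) (at x within S)"
    by (intro has_derivative_Re has_derivative_sum has_derivative_mult_right 1)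
  then show ?thesis by (simp only: cis_conv_exp mult_ac)
qed

lemma abs_Re_cis_sum_le: "\<bar>Re (\<Sum>w\<in>A. c w * cis (\<theta> w))\<bar> \<le> (\<Sum>w\<in>A. norm (c w))"
proof -
  have "\<bar>Re (\<Sum>w\<in>A. c w * cis (\<theta> w))\<bar> \<le> norm (\<Sum>w\<in>A. c w * cis (\<theta> w))"
    by (rule abs_Re_le_cmod)
  also have "\<dots> \<le> (\<Sum>w\<in>A. norm (c w * cis (\<theta> w)))" by (rule norm_sum)
  finally show ?thesis by (simp add: norm_mult)
qed

lemma continuous_on_Re_cis_sum:
  fixes \<xi> :: "'w \<Rightarrow> real ^ 3"
  shows "continuous_on UNIV (\<lambda>x. Re (\<Sum>w\<in>A. c w * cis (\<xi> w \<bullet> x)))"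
  using has_derivative_continuous_on[OF Re_cis_sum_has_derivative] .

lemma smooth_Re_cis_sum:
  fixes \<xi> :: "'w \<Rightarrow> real ^ 3" and c :: "'w \<Rightarrow> complex"
  shows "smooth (\<lambda>x. Re (\<Sum>w\<in>A. c w * cis (\<xi> w \<bullet> x)))"
  unfolding smooth_def
proof
  fix n show "Ck n (\<lambda>x. Re (\<Sum>w\<in>A. c w * cis (\<xi> w \<bullet> x)))"
  \<comment> \<open>The coefficients are generalised because differentiation multiplies each of them
    by \<open>\<i>\<close> and a component of its wave vector.\<close>
  proof (induction n arbitrary: c)
    case 0
    show ?case
      using continuous_on_Re_cis_sum by simp
  next
    case (Suc n)
    have "partial i (\<lambda>x. Re (\<Sum>w\<in>A. c w * cis (\<xi> w \<bullet> x))) =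
      (\<lambda>x. Re (\<Sum>w\<in>A. (\<i> * (\<xi> w \<bullet> axis i 1) * c w) * cis (\<xi> w \<bullet> x)))" for i
      by (intro ext partial_eq[OF Re_cis_sum_has_derivative])
    moreover have "(\<lambda>x. Re (\<Sum>w\<in>A. c w * cis (\<xi> w \<bullet> x))) differentiable at x" for x
      using Re_cis_sum_has_derivative by (rule differentiableI)
    ultimately show ?case
      using Suc by (simp del: Re_sum)
  qed
qed

section \<open>Layered series of plane waves and their regularity\<close>

locale wave_series =
  fixes W :: "nat \<Rightarrow> 'w set" and \<xi> :: "'w \<Rightarrow> real ^ 3"
begin

text \<open>For the magnetic field, layer \<open>j\<close> is the \<open>j\<close>-th Picard
  iterate; the velocity has waves in layer 0 only. Indices are abstract because several of them may
  share one wave vector.\<close>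

definition layer :: "('w \<Rightarrow> complex) \<Rightarrow> nat \<Rightarrow> real ^ 3 \<Rightarrow> real" where
  "layer c j x = Re (\<Sum>w\<in>W j. c w * cis (\<xi> w \<bullet> x))"

definition series :: "('w \<Rightarrow> complex) \<Rightarrow> real ^ 3 \<Rightarrow> real" where
  "series c x = (\<Sum>j. layer c j x)"

text \<open>Absolutely summed Fourier norm of one layer; it dominates the derivatives of the layer
  up to order \<open>k\<close>.\<close>

definition weighted :: "nat \<Rightarrow> ('w \<Rightarrow> complex) \<Rightarrow> nat \<Rightarrow> real" where
  "weighted k c j = (\<Sum>w\<in>W j. (1 + norm (\<xi> w)) ^ k * norm (c w))"

definition deriv_coeff :: "3 \<Rightarrow> ('w \<Rightarrow> complex) \<Rightarrow> 'w \<Rightarrow> complex" where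
  "deriv_coeff i c w = \<i> * (\<xi> w $ i) * c w"

text \<open>The majorant \<open>M\<close> is independent of \<open>t\<close>, so the Weierstrass
  test gives continuity jointly in time and space for derivatives up to order
  \<open>k\<close>.\<close>

definition admissible :: "nat \<Rightarrow> real set \<Rightarrow> ('w \<Rightarrow> real \<Rightarrow> complex) \<Rightarrow> bool" where
  "admissible k I C \<longleftrightarrow> (\<forall>j. \<forall>w\<in>W j. continuous_on I (C w)) \<and>
     (\<exists>M. summable M \<and> (\<forall>j. \<forall>t\<in>I. weighted k (\<lambda>w. C w t) j \<le> M j))"

lemma weighted_nonneg: "weighted k c j \<ge> 0"
  unfolding weighted_def by (intro sum_nonneg) auto

lemma abs_layer_le_sum: "\<bar>layer c j x\<bar> \<le> (\<Sum>w\<in>W j. norm (c w))"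
  unfolding layer_def by (rule abs_Re_cis_sum_le)

lemma abs_layer_le: "\<bar>layer c j x\<bar> \<le> weighted k c j"
proof -
  have "(\<Sum>w\<in>W j. 1 * norm (c w)) \<le> weighted k c j"
    unfolding weighted_def by (intro sum_mono mult_right_mono one_le_power) auto
  with abs_layer_le_sum[of c j x] show ?thesis by simp
qed

lemma weighted_deriv_coeff: "weighted k (deriv_coeff i c) j \<le> weighted (Suc k) c j"
  unfolding weighted_def deriv_coeff_def
proof (intro sum_mono)
  fix w
  have "\<bar>\<xi> w $ i\<bar> \<le> 1 + norm (\<xi> w)"
    using component_le_norm_cart[of "\<xi> w" i] by linarith
  then have "((1 + norm (\<xi> w)) ^ k * norm (c w)) * \<bar>\<xi> w $ i\<bar> \<le> ((1 + norm (\<xi> w)) ^ k * norm (c w)) * (1 + norm (\<xi> w))"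
    by (intro mult_left_mono) auto
  then show "(1 + norm (\<xi> w)) ^ k * norm (\<i> * (\<xi> w $ i) * c w) \<le> (1 + norm (\<xi> w)) ^ Suc k * norm (c w)"
    by (simp add: norm_mult mult_ac)
qed

lemma admissible_deriv_coeff:
  assumes "admissible (Suc k) I C"
  shows "admissible k I (\<lambda>w t. deriv_coeff i (\<lambda>w. C w t) w)"
proof -
  obtain M where M: "summable M" "\<And>j t. t \<in> I \<Longrightarrow> weighted (Suc k) (\<lambda>w. C w t) j \<le> M j"
    using assms unfolding admissible_def by blast
  have "weighted k (\<lambda>w. deriv_coeff i (\<lambda>w. C w t) w) j \<le> M j" if "t \<in> I" for t j
    using weighted_deriv_coeff M(2)[OF that] by (rule order_trans)
  then show ?thesis
    using assms M(1) unfolding admissible_def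
    by (auto simp: deriv_coeff_def intro!: continuous_intros)
qed

lemma admissible_Suc:
  assumes "admissible (Suc k) I C"
  shows "admissible k I C"
proof -
  obtain M where M: "summable M" "\<And>j t. t \<in> I \<Longrightarrow> weighted (Suc k) (\<lambda>w. C w t) j \<le> M j"
    using assms unfolding admissible_def by blast
  have mono: "weighted k c j \<le> weighted (Suc k) c j" for c j
    unfolding weighted_def by (intro sum_mono mult_right_mono power_increasing) auto
  have "weighted k (\<lambda>w. C w t) j \<le> M j" if "t \<in> I" for t j
    using mono M(2)[OF that] by (rule order_trans)
  then show ?thesis
    using assms M(1) unfolding admissible_def by blast
qed

lemma
  assumes "admissible k I C" "t \<in> I"
  shows summable_weighted: "summable (weighted k (\<lambda>w. C w t))"
    and sums_series: "(\<lambda>j. layer (\<lambda>w. C w t) j x) sums series (\<lambda>w. C w t) x"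
proof -
  obtain M where M: "summable M" "\<And>j. weighted k (\<lambda>w. C w t) j \<le> M j"
    using assms unfolding admissible_def by blast
  show *: "summable (weighted k (\<lambda>w. C w t))"
    by (rule summable_comparison_test'[OF M(1)]) (use M(2) in \<open>simp add: weighted_nonneg\<close>)
  show "(\<lambda>j. layer (\<lambda>w. C w t) j x) sums series (\<lambda>w. C w t) x"
    unfolding series_def
    by (intro summable_sums summable_comparison_test'[OF *]) (simp add: abs_layer_le)
qed

lemma continuous_on_series:
  assumes "admissible k I C"
  shows "continuous_on (I \<times> UNIV) (\<lambda>(t, x). series (\<lambda>w. C w t) x)"
proof -
  obtain M where M: "summable M" "\<And>j t. t \<in> I \<Longrightarrow> weighted k (\<lambda>w. C w t) j \<le> M j"
    and C: "\<And>j w. w \<in> W j \<Longrightarrow> continuous_on I (C w)"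
    using assms unfolding admissible_def by blast
  have bound: "norm (layer (\<lambda>w. C w (fst p)) j (snd p)) \<le> M j" if "p \<in> I \<times> UNIV" for j p
    using that M(2)[of "fst p" j] abs_layer_le[of "\<lambda>w. C w (fst p)" j "snd p" k] by auto
  have ul: "uniform_limit (I \<times> UNIV) (\<lambda>n p. \<Sum>j<n. layer (\<lambda>w. C w (fst p)) j (snd p))
     (\<lambda>p. \<Sum>j. layer (\<lambda>w. C w (fst p)) j (snd p)) sequentially"
    by (rule Weierstrass_m_test[OF bound M(1)])
  have C': "continuous_on (I \<times> UNIV) (\<lambda>p. C w (fst p))" if "w \<in> W j" for w j
    by (rule continuous_on_compose2[OF C[OF that] continuous_on_fst[OF continuous_on_id]]) auto
  have "continuous_on (I \<times> UNIV) (\<lambda>p. \<Sum>j<n. layer (\<lambda>w. C w (fst p)) j (snd p))" for n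
    unfolding layer_def cis_conv_exp by (intro continuous_intros C')
  with uniform_limit_theorem[OF always_eventually ul]
  have "continuous_on (I \<times> UNIV) (\<lambda>p. \<Sum>j. layer (\<lambda>w. C w (fst p)) j (snd p))"
    by simp
  then show ?thesis by (simp add: series_def case_prod_unfold)
qed

lemma continuous_on_series_slice:
  assumes "admissible k I C" "t \<in> I"
  shows "continuous_on UNIV (series (\<lambda>w. C w t))"
proof -
  have "continuous_on UNIV (\<lambda>x. (\<lambda>(t, x). series (\<lambda>w. C w t) x) (t, x))"
    by (rule continuous_on_compose2[OF continuous_on_series[OF assms(1)]])
      (use assms(2) in \<open>auto intro!: continuous_intros\<close>)
  then show ?thesis by simp
qed

lemma series_has_derivative:
  assumes "admissible 1 I C" "t \<in> I"
  shows "(series (\<lambda>w. C w t) has_derivative (\<lambda>h. series (\<lambda>w. \<i> * (\<xi> w \<bullet> h) * C w t) x)) (at x)"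
  unfolding series_def[of "\<lambda>w. \<i> * _ w * _ w"]
proof (rule sums_has_derivative[OF convex_UNIV UNIV_I])
  show "summable (weighted 1 (\<lambda>w. C w t))"
    by (rule summable_weighted[OF assms])
  show "(\<lambda>n. layer (\<lambda>w. C w t) n x) sums series (\<lambda>w. C w t) x" for x
    by (rule sums_series[OF assms])
  show "(layer (\<lambda>w. C w t) n has_derivative (\<lambda>h. layer (\<lambda>w. \<i> * (\<xi> w \<bullet> h) * C w t) n x)) (at x)" for n x
    unfolding layer_def[abs_def] by (rule Re_cis_sum_has_derivative)
  show "norm (layer (\<lambda>w. \<i> * (\<xi> w \<bullet> h) * C w t) n x) \<le> weighted 1 (\<lambda>w. C w t) n * norm h" for n x h
  proof -
    have "\<bar>\<xi> w \<bullet> h\<bar> \<le> (1 + norm (\<xi> w)) * norm h" for w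
      using Cauchy_Schwarz_ineq2[of "\<xi> w" h] by (simp add: distrib_right add_increasing)
    then have "norm (\<i> * (\<xi> w \<bullet> h) * C w t) \<le> ((1 + norm (\<xi> w)) * norm h) * norm (C w t)" for w
      unfolding norm_mult by (intro mult_right_mono) auto
    then have "(\<Sum>w\<in>W n. norm (\<i> * (\<xi> w \<bullet> h) * C w t)) \<le> (\<Sum>w\<in>W n. ((1 + norm (\<xi> w)) * norm h) * norm (C w t))"
      by (rule sum_mono)
    also have "\<dots> = weighted 1 (\<lambda>w. C w t) n * norm h"
      by (subst mult.commute) (simp add: weighted_def sum_distrib_left mult_ac)
    finally show ?thesis
      using abs_layer_le_sum[of "\<lambda>w. \<i> * (\<xi> w \<bullet> h) * C w t" n x] by (simp del: norm_mult)
  qed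
qed

lemma
  assumes "admissible 1 I C" "t \<in> I"
  shows differentiable_series: "series (\<lambda>w. C w t) differentiable at x"
    and partial_series: "partial i (series (\<lambda>w. C w t)) = series (deriv_coeff i (\<lambda>w. C w t))"
proof -
  show "series (\<lambda>w. C w t) differentiable at x"
    using series_has_derivative[OF assms] by (rule differentiableI)
  show "partial i (series (\<lambda>w. C w t)) = series (deriv_coeff i (\<lambda>w. C w t))"
    by (rule ext, subst partial_eq[OF series_has_derivative[OF assms]])
      (simp add: inner_axis deriv_coeff_def[abs_def])
qed

lemma Ck_series: "admissible k I C \<Longrightarrow> t \<in> I \<Longrightarrow> Ck k (series (\<lambda>w. C w t))"
proof (induction k arbitrary: C)
  case 0
  then show ?case by (auto intro: continuous_on_series_slice)
next
  case (Suc k)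
  have "admissible (Suc 0) I C" using Suc.prems(1)
  proof (induction k)
    case (Suc k) then show ?case using admissible_Suc by blast
  qed
  then have 1: "admissible 1 I C" by simp
  show ?case
    using Suc.IH[OF admissible_deriv_coeff[OF Suc.prems(1)] Suc.prems(2)] differentiable_series[OF 1 Suc.prems(2)]
    by (simp add: partial_series[OF 1 Suc.prems(2)])
qed

text \<open>The majorant of the differentiated series comes from \<open>C'\<close>. Its order
  \<open>l\<close> is separate from \<open>k\<close> because time derivatives cost smoothness: under
  the heat flow \<open>C'\<close> contains \<open>C\<close> times squared frequencies.\<close>

lemma series_has_vector_derivative:
  assumes C: "admissible k {0..T} C" and C': "admissible l {0..T} C'" and t: "t \<in> {0..T}"
    and D: "\<And>j w t. w \<in> W j \<Longrightarrow> t \<in> {0..T} \<Longrightarrow> (C w has_vector_derivative C' w t) (at t within {0..T})"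
  shows "((\<lambda>t. series (\<lambda>w. C w t) x) has_vector_derivative series (\<lambda>w. C' w t) x) (at t within {0..T})"
proof -
  obtain M where M: "summable M" "\<And>j t. t \<in> {0..T} \<Longrightarrow> weighted l (\<lambda>w. C' w t) j \<le> M j"
    using C' unfolding admissible_def by blast
  have "((\<lambda>t. series (\<lambda>w. C w t) x) has_derivative (\<lambda>h. \<Sum>j. h *\<^sub>R layer (\<lambda>w. C' w t) j x)) (at t within {0..T})"
  proof (rule sums_has_derivative[OF convex_real_interval(5) t _ _ M(1) sums_series[OF C]])
    fix j s assume s: "s \<in> {0..T}"
    have "((\<lambda>t. \<Sum>w\<in>W j. C w t * cis (\<xi> w \<bullet> x)) has_vector_derivative (\<Sum>w\<in>W j. C' w s * cis (\<xi> w \<bullet> x))) (at s within {0..T})"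
      by (intro has_vector_derivative_sum has_vector_derivative_mult_left D s)
    from has_derivative_Re[OF this[unfolded has_vector_derivative_def]]
    show "((\<lambda>t. layer (\<lambda>w. C w t) j x) has_derivative (\<lambda>h. h *\<^sub>R layer (\<lambda>w. C' w s) j x)) (at s within {0..T})"
      by (simp add: layer_def[abs_def] del: Re_sum)
    show "norm (h *\<^sub>R layer (\<lambda>w. C' w s) j x) \<le> M j * norm h" for h
      using order_trans[OF abs_layer_le M(2)[OF s]] by (simp add: abs_mult mult.commute[of "\<bar>h\<bar>"] mult_right_mono)
  qed
  moreover have "(\<Sum>j. h *\<^sub>R layer (\<lambda>w. C' w t) j x) = h *\<^sub>R series (\<lambda>w. C' w t) x" for h
    using sums_scaleR_right[OF sums_series[OF C' t]] by (rule sums_unique[symmetric])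
  ultimately show ?thesis by (simp add: has_vector_derivative_def)
qed

lemma periodic_series:
  assumes "\<And>j w i. w \<in> W j \<Longrightarrow> \<xi> w $ i \<in> \<int>"
  shows "periodic (series c)"
proof -
  have "cis (\<xi> w \<bullet> (x + axis i (2 * pi))) = cis (\<xi> w \<bullet> x)" if "w \<in> W j" for j w x i
  proof -
    have "cis (2 * pi * \<xi> w $ i) = 1"
      using assms[OF that] by (intro cis_multiple_2pi)
    then show ?thesis by (simp add: inner_add_right inner_axis mult_ac flip: cis_mult)
  qed
  then show ?thesis
    unfolding periodic_def series_def layer_def by (simp cong: sum.cong)
qed

text \<open>Order 2 for \<open>C\<close> provides two space derivatives, and order 0 for
  \<open>C'\<close> a continuous time derivative, as \<open>classical_field\<close> asks. Velocity
  and magnetic field differ in the direction \<open>e\<close>.\<close>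

lemma
  fixes e :: "real ^ 3"
  assumes T: "T > 0" and C: "admissible 2 {0..T} C" and C': "admissible 0 {0..T} C'"
    and D: "\<And>j w t. w \<in> W j \<Longrightarrow> t \<in> {0..T} \<Longrightarrow> (C w has_vector_derivative C' w t) (at t within {0..T})"
    and per: "\<And>j w i. w \<in> W j \<Longrightarrow> \<xi> w $ i \<in> \<int>"
  defines "v \<equiv> \<lambda>t x. series (\<lambda>w. C w t) x *\<^sub>R e"
  shows classical_field_series: "classical_field T v"
    and time_deriv_series: "\<And>t x. t \<in> {0..T} \<Longrightarrow> time_deriv T v t x = series (\<lambda>w. C' w t) x *\<^sub>R e"
    and partial_series_scaleR: "\<And>t x i. t \<in> {0..T} \<Longrightarrow> partial i (v t) = (\<lambda>x. series (deriv_coeff i (\<lambda>w. C w t)) x *\<^sub>R e)"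
    and laplacian_series: "\<And>t x. t \<in> {0..T} \<Longrightarrow> laplacian (v t) x = (\<Sum>i\<in>UNIV. series (deriv_coeff i (deriv_coeff i (\<lambda>w. C w t))) x) *\<^sub>R e"
proof -
  have C1: "admissible 1 {0..T} C" using C admissible_Suc[of 1] by (simp add: numeral_2_eq_2)
  have D1: "admissible 1 {0..T} (\<lambda>w t. deriv_coeff i (\<lambda>w. C w t) w)" for i
    by (rule admissible_deriv_coeff) (use C in \<open>simp add: numeral_2_eq_2\<close>)
  have D0: "admissible 0 {0..T} (\<lambda>w t. deriv_coeff j (\<lambda>w. deriv_coeff i (\<lambda>w. C w t) w) w)" for i j
    by (rule admissible_deriv_coeff) (use D1 in simp)
  have dv: "((\<lambda>s. v s x) has_vector_derivative series (\<lambda>w. C' w t) x *\<^sub>R e) (at t within {0..T})" if "t \<in> {0..T}" for t x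
    using has_derivative_scaleR_left[OF series_has_vector_derivative[OF C C' that D, unfolded has_vector_derivative_def]]
    by (simp add: v_def has_vector_derivative_def)
  show td: "time_deriv T v t x = series (\<lambda>w. C' w t) x *\<^sub>R e" if "t \<in> {0..T}" for t x
    unfolding time_deriv_def by (rule vector_derivative_within_closed_interval[OF T that dv[OF that]])
  show p1: "partial i (v t) = (\<lambda>x. series (deriv_coeff i (\<lambda>w. C w t)) x *\<^sub>R e)" if "t \<in> {0..T}" for t i
    unfolding v_def by (rule ext, subst partial_scaleR_const[OF differentiable_series[OF C1 that]]) (simp only: partial_series[OF C1 that])
  have p2: "partial j (partial i (v t)) = (\<lambda>x. series (deriv_coeff j (deriv_coeff i (\<lambda>w. C w t))) x *\<^sub>R e)" if "t \<in> {0..T}" for t i j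
    unfolding p1[OF that] by (rule ext, subst partial_scaleR_const[OF differentiable_series[OF D1 that]]) (simp only: partial_series[OF D1 that])
  show "laplacian (v t) x = (\<Sum>i\<in>UNIV. series (deriv_coeff i (deriv_coeff i (\<lambda>w. C w t))) x) *\<^sub>R e" if "t \<in> {0..T}" for t x
    unfolding laplacian_def p2[OF that] by (simp add: scaleR_sum_left)
  have cs: "cont_spacetime T (\<lambda>t x. series (\<lambda>w. G w t) x *\<^sub>R e)" if "admissible k {0..T} G" for k G
    unfolding cont_spacetime_def case_prod_unfold
    by (intro continuous_on_scaleR continuous_on_const) (use continuous_on_series[OF that] in \<open>simp add: case_prod_unfold\<close>)
  \<comment> \<open>The formulas for the derivatives hold for times in \<open>{0..T}\<close>, so
    continuity is transferred along equality on that slab.\<close>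
  have cong: "cont_spacetime T f" if "cont_spacetime T g" "\<And>t x. t \<in> {0..T} \<Longrightarrow> f t x = g t x" for f g :: "real \<Rightarrow> real ^ 3 \<Rightarrow> real ^ 3"
    using that(1) unfolding cont_spacetime_def by (rule continuous_on_eq) (auto simp: that(2))
  show "classical_field T v"
    unfolding classical_field_def
  proof (intro conjI ballI allI)
    fix t x i j assume t: "t \<in> {0..T}"
    show "periodic (v t)" using periodic_series[of "\<lambda>w. C w t", OF per] by (auto simp: v_def periodic_def)
    show "Ck 2 (v t)" unfolding v_def by (rule Ck_scaleR_const[OF Ck_series[OF C t]])
    show "(\<lambda>s. v s x) differentiable at t within {0..T}" using dv[OF t] by (rule differentiableI_vector)
  next
    show "cont_spacetime T v" unfolding v_def by (rule cs[OF C])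
    show "cont_spacetime T (time_deriv T v)" by (rule cong[OF cs[OF C']]) (simp add: td)
    show "cont_spacetime T (\<lambda>t. partial i (v t))" for i by (rule cong[OF cs[OF D1[where i=i]]]) (simp add: p1)
    show "cont_spacetime T (\<lambda>t. partial i (partial j (v t)))" for i j by (rule cong[OF cs[OF D0[where i=j and j=i]]]) (simp add: p2)
  qed
qed

lemma sum_deriv_coeff_deriv_coeff:
  "(\<Sum>i\<in>UNIV. deriv_coeff i (deriv_coeff i c) w) = - of_real ((norm (\<xi> w))\<^sup>2) * c w"
proof -
  have "(norm (\<xi> w))\<^sup>2 = (\<Sum>i\<in>UNIV. (\<xi> w $ i)\<^sup>2)"
    by (simp add: norm_vec_def L2_set_def sum_nonneg)
  moreover have "deriv_coeff i (deriv_coeff i c) w = - of_real ((\<xi> w $ i)\<^sup>2) * c w" for i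
  proof -
    have "deriv_coeff i (deriv_coeff i c) w = (\<i> * \<i>) * of_real ((\<xi> w $ i)\<^sup>2) * c w"
      by (simp only: deriv_coeff_def power2_eq_square of_real_mult mult_ac)
    then show ?thesis by simp
  qed
  ultimately show ?thesis by (simp add: sum_distrib_right sum_negf)
qed

lemma layer_add: "layer (\<lambda>w. c w + d w) j x = layer c j x + layer d j x"
  by (simp add: layer_def distrib_right sum.distrib)

lemma layer_sum: "layer (\<lambda>w. \<Sum>i\<in>A. c i w) j x = (\<Sum>i\<in>A. layer (c i) j x)"
proof -
  have "(\<Sum>w\<in>W j. (\<Sum>i\<in>A. c i w) * cis (\<xi> w \<bullet> x)) = (\<Sum>i\<in>A. \<Sum>w\<in>W j. c i w * cis (\<xi> w \<bullet> x))"
    by (subst sum.swap) (simp add: sum_distrib_right)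
  then show ?thesis by (simp add: layer_def)
qed

lemma series_eq_0: "(\<And>j w. w \<in> W j \<Longrightarrow> c w = 0) \<Longrightarrow> series c x = 0"
  by (simp add: series_def layer_def)

text \<open>The Laplacian is kept as a sum over layers so that it can be added to the forcing layer
  by layer.\<close>

lemma laplace_series:
  assumes "admissible 2 I C" "t \<in> I"
  shows "(\<lambda>j. layer (\<lambda>w. - of_real ((norm (\<xi> w))\<^sup>2) * C w t) j x) sums
    (\<Sum>i\<in>UNIV. series (deriv_coeff i (deriv_coeff i (\<lambda>w. C w t))) x)"
proof -
  have "admissible 0 I (\<lambda>w t. deriv_coeff i (\<lambda>w. deriv_coeff i (\<lambda>w. C w t) w) w)" for i
    by (intro admissible_deriv_coeff) (use assms(1) in \<open>simp add: numeral_2_eq_2\<close>)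
  then have "(\<lambda>j. \<Sum>i\<in>UNIV. layer (deriv_coeff i (deriv_coeff i (\<lambda>w. C w t))) j x) sums
      (\<Sum>i\<in>UNIV. series (deriv_coeff i (deriv_coeff i (\<lambda>w. C w t))) x)"
    using assms(2) by (intro sums_sum sums_series)
  then show ?thesis
    by (simp add: sum_deriv_coeff_deriv_coeff flip: layer_sum)
qed

end

section \<open>Besov norms of plane waves\<close>

text \<open>The triangle inequality gives up all phases. This costs little for lacunary frequencies
  with amplitudes proportional to the frequency: for given \<open>\<tau>\<close> essentially only
  those near \<open>1 / sqrt \<tau>\<close> count.\<close>

lemma besov_hom_norm_wave_le:
  fixes \<xi> :: "'w \<Rightarrow> real ^ 3" and c :: "'w \<Rightarrow> complex"
  assumes e: "norm e = 1"
    and bound: "\<And>\<tau>. \<tau> > 0 \<Longrightarrow> sqrt \<tau> * (\<Sum>w\<in>A. exp (- \<tau> * (norm (\<xi> w))\<^sup>2) * norm (c w)) \<le> K"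
  shows "besov_hom_norm (\<lambda>x. Re (\<Sum>w\<in>A. c w * cis (\<xi> w \<bullet> x)) *\<^sub>R e) \<le> ennreal K"
  unfolding besov_hom_norm_def
proof (rule SUP_least)
  fix \<tau> :: real assume "\<tau> \<in> {0<..}"
  then have \<tau>: "\<tau> > 0" by simp
  let ?P = "\<Sum>w\<in>A. exp (- \<tau> * (norm (\<xi> w))\<^sup>2) * norm (c w)"
  have eq: "scalar_heat \<tau> (\<lambda>x. Re (\<Sum>w\<in>A. c w * cis (\<xi> w \<bullet> x))) =
      (\<lambda>x. Re (\<Sum>w\<in>A. (exp (- \<tau> * (norm (\<xi> w))\<^sup>2) * c w) * cis (\<xi> w \<bullet> x)))"
    using scalar_heat_wave[OF \<tau>] by (intro ext) (simp add: exp_of_real)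
  have "Linf_norm (heat \<tau> (\<lambda>x. Re (\<Sum>w\<in>A. c w * cis (\<xi> w \<bullet> x)) *\<^sub>R e)) \<le> ennreal ?P"
  proof (rule Linf_norm_heat_le[OF e])
    show "continuous_on UNIV (scalar_heat \<tau> (\<lambda>x. Re (\<Sum>w\<in>A. c w * cis (\<xi> w \<bullet> x))))"
      unfolding eq by (rule continuous_on_Re_cis_sum)
    show "\<bar>scalar_heat \<tau> (\<lambda>x. Re (\<Sum>w\<in>A. c w * cis (\<xi> w \<bullet> x))) x\<bar> \<le> ?P" for x
      unfolding eq using abs_Re_cis_sum_le[of "\<lambda>w. exp (- \<tau> * (norm (\<xi> w))\<^sup>2) * c w" _ A]
      by (simp add: norm_mult del: Re_sum)
  qed
  then have "ennreal (sqrt \<tau>) * Linf_norm (heat \<tau> (\<lambda>x. Re (\<Sum>w\<in>A. c w * cis (\<xi> w \<bullet> x)) *\<^sub>R e)) \<le> ennreal (sqrt \<tau>) * ennreal ?P"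
    by (rule mult_left_mono) simp
  also have "\<dots> = ennreal (sqrt \<tau> * ?P)"
    using \<tau> by (intro ennreal_mult[symmetric]) (auto intro!: sum_nonneg)
  also have "\<dots> \<le> ennreal K" using bound[OF \<tau>] by (rule ennreal_leI)
  finally show "ennreal (sqrt \<tau>) * Linf_norm (heat \<tau> (\<lambda>x. Re (\<Sum>w\<in>A. c w * cis (\<xi> w \<bullet> x)) *\<^sub>R e)) \<le> ennreal K" .
qed

lemma besov_norm_le_besov_hom_norm: "besov_norm f \<le> besov_hom_norm f"
  unfolding besov_norm_def besov_hom_norm_def by (rule SUP_subset_mono) auto

text \<open>\<open>z exp (- z\<^sup>2)\<close> is bounded by the increment from \<open>z\<close> to \<open>2 z\<close> of \<open>5 z / (1 + z)\<close>, so the sum telescopes.\<close>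

lemma lacunary_sum_le:
  fixes y :: real
  assumes y: "y \<ge> 0"
  shows "(\<Sum>s<r. y * 2 ^ s * exp (- (y * 2 ^ s)\<^sup>2)) \<le> 5"
proof -
  have one: "z * exp (- z\<^sup>2) \<le> 5 * (2 * z / (1 + 2 * z) - z / (1 + z))" if z: "z \<ge> 0" for z :: real
  proof -
    have "exp (- z\<^sup>2) \<le> 1 / (1 + z\<^sup>2)"
      using exp_ge_add_one_self[of "z\<^sup>2"] by (simp add: exp_minus divide_inverse le_imp_inverse_le add_pos_nonneg)
    then have "z * exp (- z\<^sup>2) \<le> z * (1 / (1 + z\<^sup>2))" using z by (rule mult_left_mono)
    \<comment> \<open>The constant 5 suffices since \<open>5 * (1 + z\<^sup>2) - (1 + 2 * z) * (1 +
      z) = 4 - 3 * z + 3 * z\<^sup>2\<close> is positive.\<close>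
    also have "1 / (1 + z\<^sup>2) \<le> 5 / ((1 + 2 * z) * (1 + z))"
    proof -
      have "(1 + 2 * z) * (1 + z) \<le> 5 * (1 + z\<^sup>2)"
      proof -
        have eq: "(1 + 2 * z) * (1 + z) = 1 + 3 * z + 2 * z\<^sup>2" and "0 \<le> 1 - 2 * z + z\<^sup>2"
          using zero_le_power2[of "1 - z"] by (simp_all add: power2_eq_square algebra_simps)
        then show ?thesis unfolding eq using zero_le_power2[of z] by argo
      qed
      then show ?thesis using z by (simp add: divide_simps add_pos_nonneg mult.commute)
    qed
    also have "z * (5 / ((1 + 2 * z) * (1 + z))) = 5 * (2 * z / (1 + 2 * z) - z / (1 + z))"
      using z by (simp add: field_simps add_nonneg_eq_0_iff)
    finally show ?thesis using z by (simp add: mult_left_mono)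
  qed
  define \<phi> where "\<phi> s = 5 * (y * 2 ^ s / (1 + y * 2 ^ s))" for s :: nat
  have "(\<Sum>s<r. y * 2 ^ s * exp (- (y * 2 ^ s)\<^sup>2)) \<le> (\<Sum>s<r. \<phi> (Suc s) - \<phi> s)"
  proof (rule sum_mono)
    fix s show "y * 2 ^ s * exp (- (y * 2 ^ s)\<^sup>2) \<le> \<phi> (Suc s) - \<phi> s"
      using one[of "y * 2 ^ s"] y by (simp add: \<phi>_def algebra_simps)
  qed
  also have "\<dots> = \<phi> r - \<phi> 0" by (rule sum_lessThan_telescope)
  also have "\<dots> \<le> 5"
  proof -
    have "y * 2 ^ r / (1 + y * 2 ^ r) \<le> 1" "y / (1 + y) \<ge> 0"
      using y by (auto simp: divide_le_eq_1 add_pos_nonneg)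
    then show ?thesis by (simp add: \<phi>_def)
  qed
  finally show ?thesis .
qed

section \<open>Picard series of the passive scalar\<close>

lemma norm_axis_real: "norm (axis i a :: real ^ 'n) = \<bar>a\<bar>"
  by (simp add: norm_eq_sqrt_inner inner_axis_axis)

lemma has_integral_exp_linear:
  fixes c t :: real
  assumes "c \<noteq> 0" "t \<ge> 0"
  shows "((\<lambda>s. exp (c * s)) has_integral (exp (c * t) - 1) / c) {0..t}"
proof -
  have "((\<lambda>s. exp (c * s) / c) has_vector_derivative exp (c * s)) (at s within {0..t})" for s
    using assms(1) unfolding has_real_derivative_iff_has_vector_derivative[symmetric]
    by (auto intro!: derivative_eq_intros)
  from fundamental_theorem_of_calculus[OF assms(2) this] show ?thesis
    by (simp add: diff_divide_distrib)
qed

text \<open>Symmetry of \<open>\<Lambda>\<close> makes \<open>U\<close> real and supplies the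
  resonances \<open>\<kappa> + (- \<kappa>) = 0\<close>. The number \<open>q\<close> bounds the time
  integral of the sup norm of \<open>U\<close>, hence the ratio of successive Picard iterates;
  \<open>1 / 16\<close> leaves room for the factor \<open>4 ^ j\<close> that two space derivatives
  cost.\<close>

locale resonant_waves =
  fixes \<Lambda> :: "int set" and \<epsilon> T q :: real
  assumes finite_freqs: "finite \<Lambda>" and minus_freqs: "\<And>\<kappa>. \<kappa> \<in> \<Lambda> \<Longrightarrow> - \<kappa> \<in> \<Lambda>" and zero_freqs: "0 \<notin> \<Lambda>"
    and eps_nonneg: "0 \<le> \<epsilon>" and T_pos: "0 < T"
    and q_bound: "(\<Sum>\<kappa>\<in>\<Lambda>. \<epsilon> / (2 * \<bar>real_of_int \<kappa>\<bar>)) \<le> q" and q_le: "q \<le> 1 / 16"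
begin

text \<open>Heat evolution of the sum of \<open>\<epsilon> * k * cos (k * x\<^sub>1)\<close> over
  the positive frequencies; the factor \<open>1 / 2\<close> splits each cosine between
  \<open>k\<close> and \<open>- k\<close>.\<close>

definition amp :: "int \<Rightarrow> real \<Rightarrow> real" where
  "amp \<kappa> t = \<epsilon> * \<bar>real_of_int \<kappa>\<bar> / 2 * exp (- (real_of_int \<kappa>)\<^sup>2 * t)"

text \<open>
  The words of length \<open>j + 1\<close> index the plane waves of the \<open>j\<close>-th Picard iterate: the last letter is
  a frequency of \<open>\<beta>(0)\<close>, and each letter put in front is one interaction with \<open>U\<close>. A word
  \<open>w\<close> contributes \<open>coeff w t * cis (wvec w \<bullet> x)\<close>, with \<open>modulus\<close> given by Duhamel's formula.
\<close>

primrec modulus :: "int list \<Rightarrow> real \<Rightarrow> real" where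
  "modulus [] t = 0"
| "modulus (\<kappa> # w) t =
    (if w = [] then exp (- t) * amp \<kappa> t
     else integral {0..t} (\<lambda>s. exp (- ((real_of_int (\<kappa> + sum_list w))\<^sup>2 + 1) * (t - s)) * (amp \<kappa> s * modulus w s)))"

definition words :: "nat \<Rightarrow> int list set" where
  "words j = {w. set w \<subseteq> \<Lambda> \<and> length w = Suc j}"

text \<open>Each interaction shifts the first component by a frequency of \<open>U\<close>. The
  second stays 1, the frequency of the factor \<open>cos x\<^sub>2\<close> of the datum, because
  \<open>U\<close> is independent of \<open>x\<^sub>2\<close>.\<close>

definition wvec :: "int list \<Rightarrow> real ^ 3" where
  "wvec w = axis 1 (real_of_int (sum_list w)) + axis 2 1"

text \<open>\<open>length w - 1\<close> counts the interactions; each applies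
  \<open>- U \<partial>\<^sub>2\<close> and so contributes the phase \<open>- \<i>\<close>. The
  other factor is nonnegative on \<open>{0..T}\<close> and therefore the absolute value.\<close>

definition coeff :: "int list \<Rightarrow> real \<Rightarrow> complex" where
  "coeff w t = (- \<i>) ^ (length w - 1) * of_real (modulus w t)"

text \<open>The part of \<open>- U \<partial>\<^sub>2\<beta>\<close> carried by \<open>w\<close>:
  the source in the heat equation for \<open>coeff w\<close>.\<close>

definition forcing :: "int list \<Rightarrow> real \<Rightarrow> complex" where
  "forcing w t = (case w of [] \<Rightarrow> 0 | \<kappa> # w' \<Rightarrow> - \<i> * amp \<kappa> t * coeff w' t)"

text \<open>The sum of the initial amplitudes, a bound for the sup norms of \<open>U\<close> and of
  the initial \<open>\<beta>\<close>.\<close>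

abbreviation total where "total \<equiv> (\<Sum>\<kappa>\<in>\<Lambda>. \<epsilon> * \<bar>real_of_int \<kappa>\<bar> / 2)"

sublocale U: wave_series "\<lambda>j. if j = 0 then \<Lambda> else {}" "\<lambda>\<kappa>. axis 1 (real_of_int \<kappa>) :: real ^ 3" .
sublocale B: wave_series words wvec .

definition vel :: "real \<Rightarrow> real ^ 3 \<Rightarrow> real ^ 3" where
  "vel t x = U.series (\<lambda>\<kappa>. of_real (amp \<kappa> t)) x *\<^sub>R axis 2 1"

definition magnetic :: "real \<Rightarrow> real ^ 3 \<Rightarrow> real ^ 3" where
  "magnetic t x = B.series (\<lambda>w. coeff w t) x *\<^sub>R axis 3 1"

section \<open>Words and sums over words\<close>

lemma wvec_nth [simp]: "wvec w $ 1 = real_of_int (sum_list w)" "wvec w $ 2 = 1" "wvec w $ 3 = 0"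
  by (simp_all add: wvec_def axis_def)

lemma norm_wvec_sq: "(norm (wvec w))\<^sup>2 = (real_of_int (sum_list w))\<^sup>2 + 1"
  by (simp add: norm_vec_def L2_set_def sum_nonneg sum_3)

lemma wvec_Cons: "w \<noteq> [] \<Longrightarrow> wvec (\<kappa> # w) \<bullet> x = real_of_int \<kappa> * x $ 1 + wvec w \<bullet> x"
  by (simp add: wvec_def inner_add_left inner_axis' algebra_simps)

lemma finite_words: "finite (words j)"
  using finite_lists_length_eq[OF finite_freqs] by (simp add: words_def)

lemma words_0: "words 0 = (\<lambda>\<kappa>. [\<kappa>]) ` \<Lambda>"
  by (auto simp: words_def length_Suc_conv)

lemma words_nonempty: "w \<in> words j \<Longrightarrow> w \<noteq> []"
  by (auto simp: words_def)

lemma sum_words_0: "(\<Sum>w\<in>words 0. f w) = (\<Sum>\<kappa>\<in>\<Lambda>. f [\<kappa>])"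
  unfolding words_0 by (subst sum.reindex) (auto simp: inj_on_def)

lemma sum_words_Suc: "(\<Sum>w\<in>words (Suc j). f w) = (\<Sum>\<kappa>\<in>\<Lambda>. \<Sum>w\<in>words j. f (\<kappa> # w))"
proof -
  have "words (Suc j) = (\<lambda>(\<kappa>, w). \<kappa> # w) ` (\<Lambda> \<times> words j)"
    by (auto simp: words_def length_Suc_conv image_iff)
  then show ?thesis
    by (simp add: sum.reindex inj_on_def sum.cartesian_product case_prod_unfold)
qed

section \<open>Duhamel coefficients\<close>

lemma amp_nonneg: "amp \<kappa> t \<ge> 0"
  using eps_nonneg by (simp add: amp_def)

lemma amp_le: "t \<ge> 0 \<Longrightarrow> amp \<kappa> t \<le> \<epsilon> * \<bar>real_of_int \<kappa>\<bar> / 2"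
  using eps_nonneg mult_left_le[of "exp (- (real_of_int \<kappa>)\<^sup>2 * t)" "\<epsilon> * \<bar>real_of_int \<kappa>\<bar> / 2"]
  by (simp add: amp_def)

lemma continuous_on_amp [continuous_intros]: "continuous_on S (amp \<kappa>)"
  unfolding amp_def[abs_def] by (intro continuous_intros)

lemma modulus_Cons_has_derivative:
  assumes w: "w \<noteq> []" and cont: "continuous_on {0..T} (modulus w)" and t: "t \<in> {0..T}"
  shows "(modulus (\<kappa> # w) has_vector_derivative
      - ((real_of_int (\<kappa> + sum_list w))\<^sup>2 + 1) * modulus (\<kappa> # w) t + amp \<kappa> t * modulus w t) (at t within {0..T})"
proof -
  define a where "a = (real_of_int (\<kappa> + sum_list w))\<^sup>2 + 1"
  define f where "f s = exp (a * s) * (amp \<kappa> s * modulus w s)" for s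
  \<comment> \<open>Pulling \<open>exp (- (a * t))\<close> out of the Duhamel integral leaves an
    integrand free of \<open>t\<close>, to which the fundamental theorem of calculus
    applies.\<close>
  have eq: "modulus (\<kappa> # w) t = exp (- (a * t)) * integral {0..t} f" for t
  proof -
    have "exp (- a * (t - s)) * (amp \<kappa> s * modulus w s) = exp (- (a * t)) * f s" for s
    proof -
      have "exp (- a * (t - s)) = exp (- (a * t)) * exp (a * s)"
        unfolding exp_add[symmetric] by (rule arg_cong[where f=exp]) (simp add: right_diff_distrib)
      then show ?thesis by (simp only: f_def mult.assoc)
    qed
    then show ?thesis
      using w unfolding a_def by simp
  qed
  have "((\<lambda>t. integral {0..t} f) has_vector_derivative f t) (at t within {0..T})"
    using t by (intro integral_has_vector_derivative) (auto simp: f_def intro!: continuous_intros cont)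
  then have "((\<lambda>t. integral {0..t} f) has_real_derivative f t) (at t within {0..T})"
    by (simp add: has_real_derivative_iff_has_vector_derivative)
  then have "((\<lambda>t. exp (- (a * t)) * integral {0..t} f) has_real_derivative
      - a * exp (- (a * t)) * integral {0..t} f + exp (- (a * t)) * f t) (at t within {0..T})"
    by (auto intro!: derivative_eq_intros)
  moreover have "exp (- (a * t)) * f t = amp \<kappa> t * modulus w t"
    by (simp add: f_def exp_minus)
  ultimately show ?thesis
    unfolding a_def[symmetric] eq[abs_def]
    by (simp add: has_real_derivative_iff_has_vector_derivative mult.assoc)
qed

lemma modulus_singleton_has_derivative:
  "(modulus [\<kappa>] has_vector_derivative - ((real_of_int \<kappa>)\<^sup>2 + 1) * modulus [\<kappa>] t) (at t within S)"
  unfolding has_real_derivative_iff_has_vector_derivative[symmetric] modulus.simps amp_def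
  by (auto intro!: derivative_eq_intros simp: field_simps)

lemma continuous_on_modulus: "continuous_on {0..T} (modulus w)"
proof (induction w)
  case (Cons \<kappa> w)
  show ?case
  proof (cases "w = []")
    case True
    then show ?thesis
      using modulus_singleton_has_derivative[of \<kappa>] by (meson continuous_on_eq_continuous_within has_vector_derivative_continuous)
  next
    case False
    from modulus_Cons_has_derivative[OF this Cons] show ?thesis
      by (meson continuous_on_eq_continuous_within has_vector_derivative_continuous)
  qed
qed simp

lemma modulus_nonneg: "t \<in> {0..T} \<Longrightarrow> modulus w t \<ge> 0"
proof (induction w arbitrary: t)
  case (Cons \<kappa> w)
  have cont: "continuous_on {0..t} (modulus w)"
    using continuous_on_subset[OF continuous_on_modulus] Cons.prems by auto
  have "0 \<le> integral {0..t} (\<lambda>s. exp (- ((real_of_int (\<kappa> + sum_list w))\<^sup>2 + 1) * (t - s)) * (amp \<kappa> s * modulus w s))"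
  proof (rule integral_nonneg)
    show "0 \<le> exp (- ((real_of_int (\<kappa> + sum_list w))\<^sup>2 + 1) * (t - s)) * (amp \<kappa> s * modulus w s)" if "s \<in> {0..t}" for s
      using that Cons by (intro mult_nonneg_nonneg amp_nonneg) auto
  qed (intro integrable_continuous_real continuous_intros cont)
  then show ?case by (simp add: amp_nonneg)
qed simp

lemma modulus_0: "length w \<ge> 2 \<Longrightarrow> modulus w 0 = 0"
  by (cases w) auto

text \<open>Parabolic smoothing: integrating the decay at rate \<open>\<kappa>\<^sup>2\<close> turns
  an amplitude of order \<open>\<bar>\<kappa>\<bar>\<close> into one of order
  \<open>1 / \<bar>\<kappa>\<bar>\<close>. This is why a large lowest frequency makes the iteration
  contract.\<close>

lemma integral_amp_le:
  assumes "\<kappa> \<in> \<Lambda>" "t \<ge> 0"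
  shows "integral {0..t} (amp \<kappa>) \<le> \<epsilon> / (2 * \<bar>real_of_int \<kappa>\<bar>)"
proof -
  have nz: "real_of_int \<kappa> \<noteq> 0" using assms(1) zero_freqs by auto
  have "((\<lambda>s. - (\<epsilon> / (2 * \<bar>real_of_int \<kappa>\<bar>) * exp (- (real_of_int \<kappa>)\<^sup>2 * s))) has_real_derivative amp \<kappa> s) (at s within {0..t})" for s
    unfolding amp_def using nz
    by (auto intro!: derivative_eq_intros simp: field_simps power2_eq_square abs_if)
  then have "(amp \<kappa> has_integral (- (\<epsilon> / (2 * \<bar>real_of_int \<kappa>\<bar>) * exp (- (real_of_int \<kappa>)\<^sup>2 * t))
      - - (\<epsilon> / (2 * \<bar>real_of_int \<kappa>\<bar>) * exp (- (real_of_int \<kappa>)\<^sup>2 * 0)))) {0..t}"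
    using assms(2) by (intro fundamental_theorem_of_calculus)
      (auto simp: has_real_derivative_iff_has_vector_derivative)
  then show ?thesis
    using eps_nonneg by (simp add: integral_unique)
qed

section \<open>Geometric decay and summability of the Picard iterates\<close>

lemma
  shows total_nonneg: "total \<ge> 0" and q_nonneg: "q \<ge> 0"
proof -
  show "total \<ge> 0" using eps_nonneg by (intro sum_nonneg) auto
  have "0 \<le> (\<Sum>\<kappa>\<in>\<Lambda>. \<epsilon> / (2 * \<bar>real_of_int \<kappa>\<bar>))" using eps_nonneg by (intro sum_nonneg) auto
  with q_bound show "q \<ge> 0" by linarith
qed

text \<open>After the heat factor is bounded by 1, the sum over words splits into first letter and
  remainder. The remainder is bounded uniformly in time by induction, and the time integrals of the
  first letter sum to at most \<open>q\<close>.\<close>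

lemma sum_modulus_le:
  assumes "t \<in> {0..T}"
  shows "(\<Sum>w\<in>words j. modulus w t) \<le> total * q ^ j"
  using assms
proof (induction j arbitrary: t)
  case 0
  have "exp (- t) * amp \<kappa> t \<le> \<epsilon> * \<bar>real_of_int \<kappa>\<bar> / 2" for \<kappa>
    using amp_le[of t \<kappa>] 0 mult_right_le_one_le[of "amp \<kappa> t" "exp (- t)"] amp_nonneg[of \<kappa> t]
    by (simp add: mult.commute)
  then show ?case unfolding sum_words_0 by (simp add: sum_mono)
next
  case (Suc j)
  have cont: "continuous_on {0..t} (modulus w)" for w
    using continuous_on_subset[OF continuous_on_modulus] Suc.prems by auto
  have "(\<Sum>w\<in>words (Suc j). modulus w t) = (\<Sum>\<kappa>\<in>\<Lambda>. \<Sum>w\<in>words j. modulus (\<kappa> # w) t)"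
    by (rule sum_words_Suc)
  also have "\<dots> \<le> (\<Sum>\<kappa>\<in>\<Lambda>. \<epsilon> / (2 * \<bar>real_of_int \<kappa>\<bar>) * (total * q ^ j))"
  proof (rule sum_mono)
    fix \<kappa> assume \<kappa>: "\<kappa> \<in> \<Lambda>"
    have "(\<Sum>w\<in>words j. modulus (\<kappa> # w) t) \<le> (\<Sum>w\<in>words j. integral {0..t} (\<lambda>s. amp \<kappa> s * modulus w s))"
    proof (rule sum_mono)
      fix w assume "w \<in> words j"
      then have "modulus (\<kappa> # w) t = integral {0..t} (\<lambda>s. exp (- ((real_of_int (\<kappa> + sum_list w))\<^sup>2 + 1) * (t - s)) * (amp \<kappa> s * modulus w s))"
        using words_nonempty by auto
      also have "\<dots> \<le> integral {0..t} (\<lambda>s. amp \<kappa> s * modulus w s)"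
      proof (rule integral_le)
        fix s assume s: "s \<in> {0..t}"
        show "exp (- ((real_of_int (\<kappa> + sum_list w))\<^sup>2 + 1) * (t - s)) * (amp \<kappa> s * modulus w s) \<le> amp \<kappa> s * modulus w s"
        proof (intro mult_left_le_one_le mult_nonneg_nonneg amp_nonneg modulus_nonneg)
          show "s \<in> {0..T}" using s Suc.prems by auto
          have "- ((real_of_int (\<kappa> + sum_list w))\<^sup>2 + 1) * (t - s) \<le> 0"
            using s zero_le_power2[of "real_of_int (\<kappa> + sum_list w)"]
            by (intro mult_nonpos_nonneg) (linarith | simp)+
          then show "exp (- ((real_of_int (\<kappa> + sum_list w))\<^sup>2 + 1) * (t - s)) \<le> 1"
            by (simp only: exp_le_one_iff)
        qed simp
      qed (auto intro!: integrable_continuous_real continuous_intros cont)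
      finally show "modulus (\<kappa> # w) t \<le> integral {0..t} (\<lambda>s. amp \<kappa> s * modulus w s)" .
    qed
    also have "\<dots> = integral {0..t} (\<lambda>s. \<Sum>w\<in>words j. amp \<kappa> s * modulus w s)"
      using finite_words by (intro integral_sum[symmetric]) (auto intro!: integrable_continuous_real continuous_intros cont)
    also have "\<dots> \<le> integral {0..t} (\<lambda>s. amp \<kappa> s * (total * q ^ j))"
    proof (rule integral_le)
      fix s assume s: "s \<in> {0..t}"
      then have "(\<Sum>w\<in>words j. modulus w s) \<le> total * q ^ j" using Suc by auto
      then show "(\<Sum>w\<in>words j. amp \<kappa> s * modulus w s) \<le> amp \<kappa> s * (total * q ^ j)"
        unfolding sum_distrib_left[symmetric] by (intro mult_left_mono amp_nonneg)
    qed (auto intro!: integrable_continuous_real continuous_intros cont)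
    also have "\<dots> \<le> \<epsilon> / (2 * \<bar>real_of_int \<kappa>\<bar>) * (total * q ^ j)"
      unfolding integral_mult_left using Suc.prems total_nonneg q_nonneg
      by (intro mult_right_mono integral_amp_le[OF \<kappa>] mult_nonneg_nonneg zero_le_power) auto
    finally show "(\<Sum>w\<in>words j. modulus (\<kappa> # w) t) \<le> \<epsilon> / (2 * \<bar>real_of_int \<kappa>\<bar>) * (total * q ^ j)" .
  qed
  also have "\<dots> \<le> q * (total * q ^ j)"
    unfolding sum_distrib_right[symmetric] using q_bound total_nonneg q_nonneg by (intro mult_right_mono) auto
  finally show ?case by (simp add: mult_ac)
qed

lemma norm_coeff: "t \<in> {0..T} \<Longrightarrow> norm (coeff w t) = modulus w t"
  using modulus_nonneg by (simp add: coeff_def norm_mult norm_power)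

lemma sum_norm_coeff_le: "t \<in> {0..T} \<Longrightarrow> (\<Sum>w\<in>words j. norm (coeff w t)) \<le> total * q ^ j"
  using sum_modulus_le by (simp add: norm_coeff)

lemma continuous_on_coeff: "continuous_on {0..T} (coeff w)"
  unfolding coeff_def[abs_def] by (intro continuous_intros continuous_on_modulus)

text \<open>Wave vectors grow at most linearly in the word length while the coefficients decay
  geometrically.\<close>

lemma admissible_coeff: "B.admissible 2 {0..T} coeff"
proof -
  define N where "N = (\<Sum>\<kappa>\<in>\<Lambda>. \<bar>real_of_int \<kappa>\<bar>)"
  have N0: "N \<ge> 0" by (simp add: N_def sum_nonneg)
  have N: "\<bar>real_of_int \<kappa>\<bar> \<le> N" if "\<kappa> \<in> \<Lambda>" for \<kappa>
    unfolding N_def by (rule member_le_sum[OF that _ finite_freqs]) auto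
  have len: "\<bar>real_of_int (sum_list w)\<bar> \<le> N * length w" if "set w \<subseteq> \<Lambda>" for w
    using that
  proof (induction w)
    case (Cons \<kappa> w)
    then have "\<bar>real_of_int (sum_list w)\<bar> \<le> N * length w" "\<bar>real_of_int \<kappa>\<bar> \<le> N" using N by auto
    then show ?case by (simp add: algebra_simps)
  qed simp
  have nw: "1 + norm (wvec w) \<le> (N + 2) * 2 ^ j" if w: "w \<in> words j" for w j
  proof -
    have "norm (wvec w) \<le> norm (axis 1 (real_of_int (sum_list w)) :: real ^ 3) + norm (axis 2 (1::real) :: real ^ 3)"
      unfolding wvec_def by (rule norm_triangle_ineq)
    then have "1 + norm (wvec w) \<le> N * Suc j + 2"
      using len[of w] w by (simp add: words_def norm_axis_real)
    also have "\<dots> \<le> (N + 2) * real (Suc j)" by (simp add: algebra_simps)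
    \<comment> \<open>Linear growth is weakened to geometric; the square \<open>4 ^ j\<close> is
      absorbed by \<open>q ^ j\<close> because \<open>4 * q \<le> 1 / 4\<close>.\<close>
    also have "real (Suc j) \<le> 2 ^ j"
      using Suc_leI[OF less_exp[of j]] by (metis of_nat_le_iff of_nat_numeral of_nat_power)
    finally show ?thesis using N0 by (simp add: mult_left_mono)
  qed
  have "B.weighted 2 (\<lambda>w. coeff w t) j \<le> (N + 2)\<^sup>2 * total * (1 / 4) ^ j" if t: "t \<in> {0..T}" for j t
  proof -
    have "B.weighted 2 (\<lambda>w. coeff w t) j \<le> (\<Sum>w\<in>words j. ((N + 2) * 2 ^ j)\<^sup>2 * norm (coeff w t))"
      unfolding B.weighted_def by (intro sum_mono mult_right_mono power_mono nw) auto
    also have "\<dots> \<le> ((N + 2) * 2 ^ j)\<^sup>2 * (total * q ^ j)"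
      unfolding sum_distrib_left[symmetric] by (intro mult_left_mono sum_norm_coeff_le[OF t]) auto
    also have "\<dots> = (N + 2)\<^sup>2 * total * (4 * q) ^ j"
      by (simp add: power_mult_distrib power2_eq_square mult_ac flip: power_mult_distrib[of 2 2])
    also have "\<dots> \<le> (N + 2)\<^sup>2 * total * (1 / 4) ^ j"
      using q_le q_nonneg total_nonneg by (intro mult_left_mono power_mono) auto
    finally show ?thesis .
  qed
  moreover have "summable (\<lambda>j. (N + 2)\<^sup>2 * total * (1 / 4 :: real) ^ j)"
    by (intro summable_mult summable_geometric) simp
  ultimately show ?thesis
    unfolding B.admissible_def using continuous_on_coeff by blast
qed

lemma forcing_singleton [simp]: "forcing [\<kappa>] t = 0"
  by (simp add: forcing_def coeff_def)

lemma coeff_has_derivative: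
  assumes "w \<in> words j" and t: "t \<in> {0..T}"
  shows "(coeff w has_vector_derivative - of_real ((norm (wvec w))\<^sup>2) * coeff w t + forcing w t) (at t within {0..T})"
proof -
  obtain \<kappa> v where w: "w = \<kappa> # v" using words_nonempty[OF assms(1)] by (cases w) auto
  have lift: "(coeff w has_vector_derivative (- \<i>) ^ (length w - 1) * of_real d) (at t within {0..T})"
    if "(modulus w has_vector_derivative d) (at t within {0..T})" for d
    unfolding coeff_def[abs_def]
    by (intro has_vector_derivative_mult_right has_vector_derivative_of_real
      that[folded has_real_derivative_iff_has_vector_derivative])
  show ?thesis
  proof (cases "v = []")
    case True
    show ?thesis
      using lift[unfolded w True, OF modulus_singleton_has_derivative] unfolding w True norm_wvec_sq
      by (simp add: coeff_def)
  next
    case False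
    then have len: "(- \<i>) ^ length v = - \<i> * (- \<i>) ^ (length v - 1)"
      by (cases v) auto
    show ?thesis
      using lift[unfolded w, OF modulus_Cons_has_derivative[OF False continuous_on_modulus t]]
      unfolding w norm_wvec_sq
      by (simp add: coeff_def forcing_def len algebra_simps)
  qed
qed

lemma admissible_coeff_deriv:
  "B.admissible 0 {0..T} (\<lambda>w t. - of_real ((norm (wvec w))\<^sup>2) * coeff w t + forcing w t)"
proof -
  obtain M where M: "summable M" "\<And>j t. t \<in> {0..T} \<Longrightarrow> B.weighted 2 (\<lambda>w. coeff w t) j \<le> M j"
    using admissible_coeff unfolding B.admissible_def by blast
  have cont: "continuous_on {0..T} (forcing w)" for w
    by (cases w) (auto simp: forcing_def[abs_def] intro!: continuous_intros continuous_on_coeff)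
  \<comment> \<open>Forcing in layer \<open>j\<close> is a product of amplitudes with layer
    \<open>j - 1\<close>; the leading 16 compensates this shift of the index.\<close>
  have forcing: "(\<Sum>w\<in>words j. norm (forcing w t)) \<le> 16 * total\<^sup>2 * (1 / 16) ^ j" if t: "t \<in> {0..T}" for j t
  proof (cases j)
    case 0
    then show ?thesis by (simp add: sum_words_0)
  next
    case (Suc i)
    have "(\<Sum>w\<in>words j. norm (forcing w t)) = (\<Sum>\<kappa>\<in>\<Lambda>. amp \<kappa> t) * (\<Sum>w\<in>words i. norm (coeff w t))"
      unfolding Suc sum_words_Suc sum_product by (simp add: forcing_def norm_mult amp_nonneg)
    also have "\<dots> \<le> total * (total * q ^ i)"
      using t total_nonneg by (intro mult_mono sum_norm_coeff_le sum_mono amp_le sum_nonneg)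
        (auto simp: eps_nonneg)
    also have "\<dots> \<le> total * (total * (1 / 16) ^ i)"
      using total_nonneg q_nonneg q_le by (intro mult_left_mono power_mono) auto
    finally show ?thesis by (simp add: Suc power2_eq_square mult_ac)
  qed
  have "B.weighted 0 (\<lambda>w. - of_real ((norm (wvec w))\<^sup>2) * coeff w t + forcing w t) j \<le> M j + 16 * total\<^sup>2 * (1 / 16) ^ j"
    if t: "t \<in> {0..T}" for j t
  proof -
    have "B.weighted 0 (\<lambda>w. - of_real ((norm (wvec w))\<^sup>2) * coeff w t + forcing w t) j
       \<le> (\<Sum>w\<in>words j. (1 + norm (wvec w))\<^sup>2 * norm (coeff w t) + norm (forcing w t))"
      unfolding B.weighted_def
    proof (rule sum_mono)
      fix w
      have "norm (- of_real ((norm (wvec w))\<^sup>2) * coeff w t + forcing w t) \<le> (norm (wvec w))\<^sup>2 * norm (coeff w t) + norm (forcing w t)"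
        by (rule order_trans[OF norm_triangle_ineq]) (simp add: norm_mult norm_power)
      also have "(norm (wvec w))\<^sup>2 * norm (coeff w t) \<le> (1 + norm (wvec w))\<^sup>2 * norm (coeff w t)"
        by (intro mult_right_mono power_mono) auto
      finally show "(1 + norm (wvec w)) ^ 0 * norm (- of_real ((norm (wvec w))\<^sup>2) * coeff w t + forcing w t)
        \<le> (1 + norm (wvec w))\<^sup>2 * norm (coeff w t) + norm (forcing w t)" by simp
    qed
    also have "\<dots> = B.weighted 2 (\<lambda>w. coeff w t) j + (\<Sum>w\<in>words j. norm (forcing w t))"
      by (simp add: B.weighted_def sum.distrib)
    also have "\<dots> \<le> M j + 16 * total\<^sup>2 * (1 / 16) ^ j"
      using M(2)[OF t] forcing[OF t] by (rule add_mono)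
    finally show ?thesis .
  qed
  moreover have "summable (\<lambda>j. M j + 16 * total\<^sup>2 * (1 / 16 :: real) ^ j)"
    by (intro summable_add M(1) summable_mult summable_geometric) simp
  moreover have "continuous_on {0..T} (\<lambda>t. - of_real ((norm (wvec w))\<^sup>2) * coeff w t + forcing w t)" for w
    by (intro continuous_intros cont continuous_on_coeff)
  ultimately show ?thesis unfolding B.admissible_def by blast
qed

section \<open>Verification of the MHD system\<close>

lemma admissible_amp:
  "U.admissible k {0..T} (\<lambda>\<kappa> t. of_real (c \<kappa> * amp \<kappa> t))"
proof -
  define K where "K = (\<Sum>\<kappa>\<in>\<Lambda>. (1 + norm (axis 1 (real_of_int \<kappa>) :: real ^ 3)) ^ k * (\<bar>c \<kappa>\<bar> * (\<epsilon> * \<bar>real_of_int \<kappa>\<bar> / 2)))"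
  have "U.weighted k (\<lambda>\<kappa>. of_real (c \<kappa> * amp \<kappa> t)) j \<le> (if j = 0 then K else 0)" if "t \<in> {0..T}" for j t
  proof (cases "j = 0")
    case True
    have "U.weighted k (\<lambda>\<kappa>. of_real (c \<kappa> * amp \<kappa> t)) 0 \<le> K"
      unfolding U.weighted_def K_def of_real_mult norm_mult norm_of_real using that
      by (auto simp: amp_nonneg intro!: sum_mono mult_left_mono amp_le simp del: times_divide_eq_right)
    then show ?thesis using True by simp
  qed (simp add: U.weighted_def)
  moreover have "summable (\<lambda>j::nat. if j = 0 then K else 0)"
    by (rule summable_finite[of "{0}"]) auto
  moreover have "continuous_on {0..T} (\<lambda>t. complex_of_real (c \<kappa> * amp \<kappa> t))" for \<kappa>
    by (intro continuous_intros)
  ultimately show ?thesis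
    unfolding U.admissible_def by blast
qed

text \<open>The sines cancel between \<open>\<kappa>\<close> and \<open>- \<kappa>\<close>. Since
  the sum is real, it can later be taken out of a real part.\<close>

lemma sum_amp_cis: "(\<Sum>\<kappa>\<in>\<Lambda>. of_real (amp \<kappa> t) * cis (real_of_int \<kappa> * a)) = of_real (\<Sum>\<kappa>\<in>\<Lambda>. amp \<kappa> t * cos (real_of_int \<kappa> * a))"
proof -
  have "(\<Sum>\<kappa>\<in>\<Lambda>. amp \<kappa> t * sin (real_of_int \<kappa> * a)) = (\<Sum>\<kappa>\<in>\<Lambda>. amp (- \<kappa>) t * sin (real_of_int (- \<kappa>) * a))"
    by (rule sum.reindex_bij_witness[of _ uminus uminus]) (use minus_freqs in auto)
  then have "(\<Sum>\<kappa>\<in>\<Lambda>. amp \<kappa> t * sin (real_of_int \<kappa> * a)) = 0"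
    by (simp add: amp_def sum_negf)
  then show ?thesis by (simp add: complex_eq_iff)
qed

lemma U_series_eq: "U.series c x = Re (\<Sum>\<kappa>\<in>\<Lambda>. c \<kappa> * cis (real_of_int \<kappa> * x $ 1))"
proof -
  have "U.series c x = (\<Sum>j\<in>{0}. U.layer c j x)"
    unfolding U.series_def by (rule suminf_finite) (auto simp: U.layer_def)
  then show ?thesis by (simp add: U.layer_def inner_axis')
qed

lemma layer_forcing_0: "B.layer (\<lambda>w. forcing w t) 0 x = 0"
  by (simp add: B.layer_def sum_words_0)

text \<open>A prefixed letter multiplies the wave by \<open>cis (\<kappa> * x\<^sub>1)\<close>, so
  the double sum is a product: the first factor is the real number \<open>U\<close>, and
  \<open>\<i>\<close> in the second is the symbol of \<open>\<partial>\<^sub>2\<close>.\<close>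

lemma layer_forcing_Suc:
  "B.layer (\<lambda>w. forcing w t) (Suc j) x =
     - U.series (\<lambda>\<kappa>. of_real (amp \<kappa> t)) x * B.layer (B.deriv_coeff 2 (\<lambda>w. coeff w t)) j x"
proof -
  have U: "(\<Sum>\<kappa>\<in>\<Lambda>. of_real (amp \<kappa> t) * cis (real_of_int \<kappa> * x $ 1)) = of_real (U.series (\<lambda>\<kappa>. of_real (amp \<kappa> t)) x)"
    unfolding U_series_eq sum_amp_cis by simp
  have "(\<Sum>w\<in>words (Suc j). forcing w t * cis (wvec w \<bullet> x))
    = (\<Sum>\<kappa>\<in>\<Lambda>. \<Sum>w\<in>words j. (of_real (amp \<kappa> t) * cis (real_of_int \<kappa> * x $ 1)) * (- (\<i> * coeff w t * cis (wvec w \<bullet> x))))"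
    unfolding sum_words_Suc
    by (intro sum.cong refl) (simp add: forcing_def wvec_Cons words_nonempty mult_ac flip: cis_mult)
  also have "\<dots> = of_real (U.series (\<lambda>\<kappa>. of_real (amp \<kappa> t)) x) * - (\<Sum>w\<in>words j. \<i> * coeff w t * cis (wvec w \<bullet> x))"
    unfolding U[symmetric] sum_product sum_negf[symmetric] ..
  finally show ?thesis
    by (simp add: B.layer_def B.deriv_coeff_def del: Re_sum)
qed

text \<open>The passive scalar equation. Layer \<open>j + 1\<close> is forced by layer
  \<open>j\<close> and layer 0 is unforced, so summing over all layers closes the equation.\<close>

lemma series_coeff_deriv:
  assumes t: "t \<in> {0..T}"
  shows "B.series (\<lambda>w. - of_real ((norm (wvec w))\<^sup>2) * coeff w t + forcing w t) x =
    (\<Sum>i\<in>UNIV. B.series (B.deriv_coeff i (B.deriv_coeff i (\<lambda>w. coeff w t))) x)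
    - U.series (\<lambda>\<kappa>. of_real (amp \<kappa> t)) x * B.series (B.deriv_coeff 2 (\<lambda>w. coeff w t)) x"
proof -
  have 1: "B.admissible 1 {0..T} (\<lambda>w t. B.deriv_coeff 2 (\<lambda>w. coeff w t) w)"
    by (rule B.admissible_deriv_coeff) (use admissible_coeff in \<open>simp add: numeral_2_eq_2\<close>)
  have "(\<lambda>j. B.layer (\<lambda>w. forcing w t) (Suc j) x) sums
      (- U.series (\<lambda>\<kappa>. of_real (amp \<kappa> t)) x * B.series (B.deriv_coeff 2 (\<lambda>w. coeff w t)) x)"
    unfolding layer_forcing_Suc by (intro sums_mult B.sums_series[OF 1 t])
  then have 2: "(\<lambda>j. B.layer (\<lambda>w. forcing w t) j x) sums
      (- U.series (\<lambda>\<kappa>. of_real (amp \<kappa> t)) x * B.series (B.deriv_coeff 2 (\<lambda>w. coeff w t)) x)"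
    by (subst (asm) sums_Suc_iff) (simp add: layer_forcing_0)
  have "(\<lambda>j. B.layer (\<lambda>w. - of_real ((norm (wvec w))\<^sup>2) * coeff w t + forcing w t) j x) sums
      ((\<Sum>i\<in>UNIV. B.series (B.deriv_coeff i (B.deriv_coeff i (\<lambda>w. coeff w t))) x)
        + - U.series (\<lambda>\<kappa>. of_real (amp \<kappa> t)) x * B.series (B.deriv_coeff 2 (\<lambda>w. coeff w t)) x)"
    unfolding B.layer_add by (intro sums_add B.laplace_series[OF admissible_coeff t] 2)
  from sums_unique2[OF B.sums_series[OF admissible_coeff_deriv t] this]
  show ?thesis by simp
qed

lemma mhd_solution_waves: "mhd_solution T vel magnetic (\<lambda>t x. 0)"
proof -
  let ?A = "\<lambda>\<kappa> t. complex_of_real (amp \<kappa> t)"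
  let ?A' = "\<lambda>\<kappa> t. complex_of_real (- (real_of_int \<kappa>)\<^sup>2 * amp \<kappa> t)"
  let ?B' = "\<lambda>w t. - of_real ((norm (wvec w))\<^sup>2) * coeff w t + forcing w t"
  have A: "U.admissible k {0..T} ?A" for k using admissible_amp[of k "\<lambda>_. 1"] by simp
  have A': "U.admissible 0 {0..T} ?A'" by (rule admissible_amp)
  have dA: "(?A \<kappa> has_vector_derivative ?A' \<kappa> t) (at t within {0..T})" for \<kappa> t
    by (intro has_vector_derivative_of_real) (auto simp: amp_def intro!: derivative_eq_intros)
  have perA: "(axis 1 (real_of_int \<kappa>) :: real ^ 3) $ i \<in> \<int>" for \<kappa> i
    by (simp add: axis_def)
  have perB: "wvec w $ i \<in> \<int>" for w i
    by (auto simp: wvec_def axis_def)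
  have vel_fold: "(\<lambda>x. U.series (\<lambda>\<kappa>. ?A \<kappa> t) x *\<^sub>R axis 2 1) = vel t" for t
    by (simp add: vel_def[abs_def])
  have magnetic_fold: "(\<lambda>x. B.series (\<lambda>w. coeff w t) x *\<^sub>R axis 3 1) = magnetic t" for t
    by (simp add: magnetic_def[abs_def])
  note u_classical = U.classical_field_series[where e = "axis 2 1", OF T_pos A A' dA perA, unfolded vel_fold]
  note u_time = U.time_deriv_series[where e = "axis 2 1", OF T_pos A A' dA perA, unfolded vel_fold]
  note u_partial = U.partial_series_scaleR[where e = "axis 2 1", OF T_pos A A' dA perA, unfolded vel_fold]
  note u_laplace = U.laplacian_series[where e = "axis 2 1", OF T_pos A A' dA perA, unfolded vel_fold]
  have b_classical: "classical_field T magnetic"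
    by (rule B.classical_field_series[where e = "axis 3 1", OF T_pos admissible_coeff admissible_coeff_deriv _ perB, unfolded magnetic_fold])
      (rule coeff_has_derivative)
  have b_time: "time_deriv T magnetic t x = B.series (\<lambda>w. ?B' w t) x *\<^sub>R axis 3 1" if "t \<in> {0..T}" for t x
    by (rule B.time_deriv_series[where e = "axis 3 1", OF T_pos admissible_coeff admissible_coeff_deriv _ perB that, unfolded magnetic_fold])
      (rule coeff_has_derivative)
  have b_partial: "partial i (magnetic t) = (\<lambda>x. B.series (B.deriv_coeff i (\<lambda>w. coeff w t)) x *\<^sub>R axis 3 1)" if "t \<in> {0..T}" for t i
    by (rule B.partial_series_scaleR[where e = "axis 3 1", OF T_pos admissible_coeff admissible_coeff_deriv _ perB that, unfolded magnetic_fold])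
      (rule coeff_has_derivative)
  have b_laplace: "laplacian (magnetic t) x = (\<Sum>i\<in>UNIV. B.series (B.deriv_coeff i (B.deriv_coeff i (\<lambda>w. coeff w t))) x) *\<^sub>R axis 3 1" if "t \<in> {0..T}" for t x
    by (rule B.laplacian_series[where e = "axis 3 1", OF T_pos admissible_coeff admissible_coeff_deriv _ perB that, unfolded magnetic_fold])
      (rule coeff_has_derivative)
  have zero: "partial i (\<lambda>x. 0 :: real) = (\<lambda>x. 0)" for i
    by (rule ext, rule partial_eq) auto
  have "classical_pressure T (\<lambda>t x. 0)"
    by (auto simp: classical_pressure_def periodic_def cont_spacetime_def zero case_prod_unfold numeral_eq_Suc)
  moreover have "time_deriv T vel t x - laplacian (vel t) x + advect (vel t) (vel t) x
          - advect (magnetic t) (magnetic t) x + gradient (\<lambda>x. 0) x = 0 \<and>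
        time_deriv T magnetic t x - laplacian (magnetic t) x + advect (vel t) (magnetic t) x
          - advect (magnetic t) (vel t) x = 0 \<and>
        divergence (vel t) x = 0 \<and> divergence (magnetic t) x = 0" if t: "t \<in> {0..T}" for t x
  proof -
    have A1: "U.admissible 1 {0..T} ?A" by (rule A)
    have B1: "B.admissible 1 {0..T} coeff"
      by (rule B.admissible_Suc) (use admissible_coeff in \<open>simp add: numeral_2_eq_2\<close>)
    have U0: "U.series (U.deriv_coeff i (\<lambda>\<kappa>. ?A \<kappa> t)) x = 0" if "i \<noteq> 1" for i x
    proof (rule U.series_eq_0)
      have "(axis 1 (real_of_int \<kappa>) :: real ^ 3) $ i = 0" for \<kappa>
        using that by (simp add: axis_def)
      then show "U.deriv_coeff i (\<lambda>\<kappa>. ?A \<kappa> t) \<kappa> = 0" for \<kappa>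
        by (simp add: U.deriv_coeff_def)
    qed
    have B0: "B.series (B.deriv_coeff 3 (\<lambda>w. coeff w t)) x = 0" for x
      by (intro B.series_eq_0) (auto simp: B.deriv_coeff_def)
    have "time_deriv T vel t x = laplacian (vel t) x"
    proof -
      have "?A' \<kappa> t = - of_real ((norm (axis 1 (real_of_int \<kappa>) :: real ^ 3))\<^sup>2) * ?A \<kappa> t" for \<kappa>
        by (simp add: norm_axis_real)
      then have "U.series (\<lambda>\<kappa>. ?A' \<kappa> t) x = (\<Sum>i\<in>UNIV. U.series (U.deriv_coeff i (U.deriv_coeff i (\<lambda>\<kappa>. ?A \<kappa> t))) x)"
        unfolding U.series_def[of "\<lambda>\<kappa>. ?A' \<kappa> t"]
        using U.laplace_series[OF A t, of x] by (simp only: sums_iff)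
      then show ?thesis by (simp only: u_time[OF t] u_laplace[OF t])
    qed
    \<comment> \<open>The derivatives involved are \<open>\<partial>\<^sub>2\<close> and
      \<open>\<partial>\<^sub>3\<close> of the velocity, which depends on \<open>x\<^sub>1\<close>
      alone, and \<open>\<partial>\<^sub>3\<close> of the magnetic field, which does not depend on
      \<open>x\<^sub>3\<close>.\<close>
    moreover have "advect (vel t) (vel t) x = 0" "advect (magnetic t) (vel t) x = 0" "advect (magnetic t) (magnetic t) x = 0"
      unfolding vel_def[of t, abs_def] magnetic_def[of t, abs_def] advect_scaleR_axis
      unfolding vel_def[of t, abs_def, symmetric] magnetic_def[of t, abs_def, symmetric]
      by (simp_all add: u_partial[OF t] b_partial[OF t] U0 B0)
    moreover have "advect (vel t) (magnetic t) x =
        (U.series (\<lambda>\<kappa>. ?A \<kappa> t) x * B.series (B.deriv_coeff 2 (\<lambda>w. coeff w t)) x) *\<^sub>R axis 3 1"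
      unfolding vel_def[of t, abs_def] advect_scaleR_axis b_partial[OF t] by simp
    moreover have "divergence (vel t) x = 0"
      unfolding vel_def[of t, abs_def] divergence_scaleR_axis[OF U.differentiable_series[OF A1 t]]
        U.partial_series[OF A1 t] by (rule U0) simp
    moreover have "divergence (magnetic t) x = 0"
      unfolding magnetic_def[of t, abs_def] divergence_scaleR_axis[OF B.differentiable_series[OF B1 t]]
        B.partial_series[OF B1 t] by (rule B0)
    moreover have "gradient (\<lambda>x. 0) x = 0"
      by (simp add: gradient_def zero vec_eq_iff)
    ultimately show ?thesis
      unfolding b_time[OF t] b_laplace[OF t] series_coeff_deriv[OF t]
      by (simp add: scaleR_left_diff_distrib)
  qed
  ultimately show ?thesis
    unfolding mhd_solution_def using u_classical b_classical by blast
qed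

section \<open>Besov norms of the velocity and of the initial magnetic field\<close>

definition profile :: "real \<Rightarrow> real" where
  "profile \<tau> = (\<Sum>\<kappa>\<in>\<Lambda>. \<epsilon> * \<bar>real_of_int \<kappa>\<bar> / 2 * exp (- \<tau> * (real_of_int \<kappa>)\<^sup>2))"

lemma vel_eq:
  "vel t = (\<lambda>x. Re (\<Sum>\<kappa>\<in>\<Lambda>. complex_of_real (amp \<kappa> t) * cis ((axis 1 (real_of_int \<kappa>) :: real ^ 3) \<bullet> x)) *\<^sub>R axis 2 1)"
  by (simp add: vel_def[abs_def] U_series_eq inner_axis' del: Re_sum)

text \<open>\<open>profile \<tau>\<close> sums the initial amplitudes after heating for time
  \<open>\<tau>\<close>. Amplitudes only decay in \<open>t\<close>, so it serves for every
  \<open>t \<ge> 0\<close>.\<close>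

lemma besov_hom_norm_vel_le:
  assumes K: "\<And>\<tau>. \<tau> > 0 \<Longrightarrow> sqrt \<tau> * profile \<tau> \<le> K" and t: "t \<ge> 0"
  shows "besov_hom_norm (vel t) \<le> ennreal K"
unfolding vel_eq
proof (rule besov_hom_norm_wave_le)
  fix \<tau> :: real assume \<tau>: "\<tau> > 0"
  have "(\<Sum>\<kappa>\<in>\<Lambda>. exp (- \<tau> * (norm (axis 1 (real_of_int \<kappa>) :: real ^ 3))\<^sup>2) * norm (complex_of_real (amp \<kappa> t))) \<le> profile \<tau>"
    unfolding profile_def using amp_le[OF t]
    by (intro sum_mono) (simp add: norm_axis_real amp_nonneg mult.commute mult_left_mono)
  then have "sqrt \<tau> * (\<Sum>\<kappa>\<in>\<Lambda>. exp (- \<tau> * (norm (axis 1 (real_of_int \<kappa>) :: real ^ 3))\<^sup>2) * norm (complex_of_real (amp \<kappa> t))) \<le> sqrt \<tau> * profile \<tau>"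
    using \<tau> by (intro mult_left_mono) auto
  with K[OF \<tau>] show "sqrt \<tau> * (\<Sum>\<kappa>\<in>\<Lambda>. exp (- \<tau> * (norm (axis 1 (real_of_int \<kappa>) :: real ^ 3))\<^sup>2) * norm (complex_of_real (amp \<kappa> t))) \<le> K"
    by linarith
qed simp

lemma heated_words_0_le:
  assumes t: "t \<in> {0..T}" and \<tau>: "\<tau> > 0"
  shows "(\<Sum>w\<in>words 0. exp (- \<tau> * (norm (wvec w))\<^sup>2) * norm (coeff w t)) \<le> profile \<tau>"
  unfolding sum_words_0 profile_def
proof (rule sum_mono)
  fix \<kappa>
  have "exp (- \<tau> * ((real_of_int \<kappa>)\<^sup>2 + 1)) * (exp (- t) * amp \<kappa> t) \<le> exp (- \<tau> * (real_of_int \<kappa>)\<^sup>2) * (1 * (\<epsilon> * \<bar>real_of_int \<kappa>\<bar> / 2))"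
    using t \<tau> by (intro mult_mono amp_le mult_nonneg_nonneg amp_nonneg) auto
  then show "exp (- \<tau> * (norm (wvec [\<kappa>]))\<^sup>2) * norm (coeff [\<kappa>] t) \<le> \<epsilon> * \<bar>real_of_int \<kappa>\<bar> / 2 * exp (- \<tau> * (real_of_int \<kappa>)\<^sup>2)"
    unfolding norm_coeff[OF t] norm_wvec_sq by (simp add: mult.commute)
qed

text \<open>Only layer 0 is present initially, since every Duhamel integral is empty at time
  0.\<close>

lemma magnetic_0: "magnetic 0 = (\<lambda>x. Re (\<Sum>w\<in>words 0. coeff w 0 * cis (wvec w \<bullet> x)) *\<^sub>R axis 3 1)"
proof -
  have "B.series (\<lambda>w. coeff w 0) x = (\<Sum>j\<in>{0}. B.layer (\<lambda>w. coeff w 0) j x)" for x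
    unfolding B.series_def
  proof (rule suminf_finite)
    fix j :: nat assume "j \<notin> {0}"
    then have j: "j \<ge> 1" by simp
    have "coeff w 0 = 0" if w: "w \<in> words j" for w
    proof -
      have "length w = Suc j" using w by (simp add: words_def)
      then have "modulus w 0 = 0" using j by (intro modulus_0) linarith
      then show ?thesis by (simp add: coeff_def)
    qed
    then show "B.layer (\<lambda>w. coeff w 0) j x = 0" by (simp add: B.layer_def)
  qed simp
  then show ?thesis by (simp add: magnetic_def[abs_def] B.layer_def del: Re_sum)
qed

lemma besov_hom_norm_magnetic_0_le:
  assumes K: "\<And>\<tau>. \<tau> > 0 \<Longrightarrow> sqrt \<tau> * profile \<tau> \<le> K"
  shows "besov_hom_norm (magnetic 0) \<le> ennreal K"
  unfolding magnetic_0
proof (rule besov_hom_norm_wave_le)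
  fix \<tau> :: real assume \<tau>: "\<tau> > 0"
  have "sqrt \<tau> * (\<Sum>w\<in>words 0. exp (- \<tau> * (norm (wvec w))\<^sup>2) * norm (coeff w 0)) \<le> sqrt \<tau> * profile \<tau>"
    using \<tau> T_pos by (intro mult_left_mono heated_words_0_le) auto
  with K[OF \<tau>] show "sqrt \<tau> * (\<Sum>w\<in>words 0. exp (- \<tau> * (norm (wvec w))\<^sup>2) * norm (coeff w 0)) \<le> K"
    by linarith
qed simp

lemma smooth_initial: "smooth (vel 0)" "smooth (magnetic 0)"
  unfolding vel_eq magnetic_0 by (rule smooth_scaleR_const[OF smooth_Re_cis_sum])+

section \<open>Growth of the low mode of the magnetic field\<close>

lemma modulus_resonant_pair:
  assumes \<kappa>: "\<kappa> \<in> \<Lambda>"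
  shows "modulus [\<kappa>, - \<kappa>] T = exp (- T) * (\<epsilon>\<^sup>2 / 8 * (1 - exp (- 2 * (real_of_int \<kappa>)\<^sup>2 * T)))"
proof -
  define k where "k = real_of_int \<kappa>"
  have k: "k \<noteq> 0" using \<kappa> zero_freqs by (auto simp: k_def)
  \<comment> \<open>At resonance the first frequency component is 0, so only the decay of the mode
    in \<open>x\<^sub>2\<close> remains and combines to \<open>exp (- T)\<close>. The rest
    integrates to a quantity that hardly depends on \<open>k\<close> once
    \<open>k\<^sup>2 * T \<ge> 1\<close>.\<close>
  have "exp (- ((real_of_int (\<kappa> + sum_list [- \<kappa>]))\<^sup>2 + 1) * (T - s)) * (amp \<kappa> s * modulus [- \<kappa>] s)
      = exp (- T) * (\<epsilon>\<^sup>2 * k\<^sup>2 / 4 * exp (- 2 * k\<^sup>2 * s))" for s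
  proof -
    have 1: "exp (- (T - s)) * exp (- s) = exp (- T)"
      unfolding exp_add[symmetric] by (rule arg_cong[where f=exp]) simp
    have 2: "exp (- k\<^sup>2 * s) * exp (- k\<^sup>2 * s) = exp (- 2 * k\<^sup>2 * s)"
      unfolding exp_add[symmetric] by (rule arg_cong[where f=exp]) simp
    have "exp (- ((real_of_int (\<kappa> + sum_list [- \<kappa>]))\<^sup>2 + 1) * (T - s)) * (amp \<kappa> s * modulus [- \<kappa>] s)
        = exp (- (T - s)) * (amp \<kappa> s * (exp (- s) * amp (- \<kappa>) s))" by simp
    also have "\<dots> =
        (exp (- (T - s)) * exp (- s)) * (\<epsilon>\<^sup>2 * (\<bar>k\<bar> * \<bar>k\<bar>) / 4 * (exp (- k\<^sup>2 * s) * exp (- k\<^sup>2 * s)))"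
      unfolding amp_def k_def of_int_minus abs_minus_cancel power2_minus power2_eq_square[of \<epsilon>]
        times_divide_eq_right times_divide_eq_left divide_divide_eq_left
      by (simp only: mult_ac)
    finally show ?thesis unfolding 1 2 by (simp only: power2_eq_square abs_mult_self_eq)
  qed
  then have "integral {0..T} (\<lambda>s. exp (- ((real_of_int (\<kappa> + sum_list [- \<kappa>]))\<^sup>2 + 1) * (T - s)) * (amp \<kappa> s * modulus [- \<kappa>] s))
      = exp (- T) * integral {0..T} (\<lambda>s. \<epsilon>\<^sup>2 * k\<^sup>2 / 4 * exp (- 2 * k\<^sup>2 * s))"
    by (simp only: integral_mult_right)
  moreover have "modulus [\<kappa>, - \<kappa>] T = integral {0..T} (\<lambda>s. exp (- ((real_of_int (\<kappa> + sum_list [- \<kappa>]))\<^sup>2 + 1) * (T - s)) * (amp \<kappa> s * modulus [- \<kappa>] s))"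
    by (subst modulus.simps(2)) (simp only: list.distinct if_False)
  ultimately have eq: "modulus [\<kappa>, - \<kappa>] T = exp (- T) * integral {0..T} (\<lambda>s. \<epsilon>\<^sup>2 * k\<^sup>2 / 4 * exp (- 2 * k\<^sup>2 * s))"
    by (rule trans[rotated])
  have "((\<lambda>s. \<epsilon>\<^sup>2 * k\<^sup>2 / 4 * exp (- 2 * k\<^sup>2 * s)) has_integral
      \<epsilon>\<^sup>2 * k\<^sup>2 / 4 * ((exp (- 2 * k\<^sup>2 * T) - 1) / (- 2 * k\<^sup>2))) {0..T}"
    using k T_pos by (intro has_integral_mult_right has_integral_exp_linear) auto
  then have "integral {0..T} (\<lambda>s. \<epsilon>\<^sup>2 * k\<^sup>2 / 4 * exp (- 2 * k\<^sup>2 * s)) =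
      \<epsilon>\<^sup>2 * k\<^sup>2 / 4 * ((exp (- 2 * k\<^sup>2 * T) - 1) / (- 2 * k\<^sup>2))"
    by (rule integral_unique)
  also have "\<dots> = \<epsilon>\<^sup>2 / 8 * (1 - exp (- 2 * k\<^sup>2 * T))"
    using k by (simp add: field_simps)
  finally have "integral {0..T} (\<lambda>s. \<epsilon>\<^sup>2 * k\<^sup>2 / 4 * exp (- 2 * k\<^sup>2 * s)) = \<epsilon>\<^sup>2 / 8 * (1 - exp (- 2 * k\<^sup>2 * T))" .
  then show ?thesis
    unfolding eq by (simp only: k_def)
qed

text \<open>The four terms are the resonant words of length 2, layer 0, the nonresonant words of
  length 2, and all later layers. Nonresonant words have a nonzero multiple of \<open>L\<close> as
  first frequency, so heating for time 1 gains \<open>exp (- L\<^sup>2)\<close>.\<close>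

lemma scalar_heat_magnetic_ge:
  assumes dvd: "\<And>\<kappa>. \<kappa> \<in> \<Lambda> \<Longrightarrow> L dvd \<kappa>" and L: "L > 0" and LT: "(real_of_int L)\<^sup>2 * T \<ge> 1" and T1: "T \<le> 1"
    and x: "sin (x $ 2) \<ge> 1 / 2"
  shows "scalar_heat 1 (B.series (\<lambda>w. coeff w T)) x \<ge>
    card \<Lambda> * \<epsilon>\<^sup>2 / 288 - profile 1 - exp (- (real_of_int L)\<^sup>2) * (total * q) - 2 * (total * q\<^sup>2)"
proof -
  let ?c = "\<lambda>w. coeff w T"
  have T: "T \<in> {0..T}" using T_pos by simp
  have adm: "B.admissible 2 {0..T} coeff" by (rule admissible_coeff)
  define R where "R x = B.series ?c x - B.layer ?c 0 x - B.layer ?c 1 x" for x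
  have layer_cont: "continuous_on UNIV (B.layer ?c j)" for j
    unfolding B.layer_def[abs_def] by (rule continuous_on_Re_cis_sum)
  have layer_le: "\<bar>B.layer ?c j x\<bar> \<le> total * q ^ j" for j x
    using order_trans[OF B.abs_layer_le_sum sum_norm_coeff_le[OF T]] .
  have R_cont: "continuous_on UNIV R"
    unfolding R_def[abs_def] by (intro continuous_intros layer_cont B.continuous_on_series_slice[OF adm T])
  have R_le: "\<bar>R x\<bar> \<le> 2 * (total * q\<^sup>2)" for x
  proof -
    have s: "summable (\<lambda>j. B.layer ?c j x)"
      using B.sums_series[OF adm T] by (rule sums_summable)
    have "R x = (\<Sum>j. B.layer ?c (j + 2) x)"
      unfolding R_def B.series_def by (subst suminf_split_initial_segment[OF s, of 2]) (simp add: numeral_2_eq_2)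
    moreover have g: "summable (\<lambda>j. total * q\<^sup>2 * q ^ j)"
      using q_nonneg q_le by (intro summable_mult summable_geometric) auto
    have "norm (\<Sum>j. B.layer ?c (j + 2) x) \<le> (\<Sum>j. total * q\<^sup>2 * q ^ j)"
    proof (rule norm_suminf_le[OF _ g])
      show "norm (B.layer ?c (j + 2) x) \<le> total * q\<^sup>2 * q ^ j" for j
        using layer_le[of "j + 2" x] by (simp add: power2_eq_square mult_ac)
    qed
    also have "\<dots> = total * q\<^sup>2 * (1 / (1 - q))"
      using q_nonneg q_le by (subst suminf_mult) (auto intro!: summable_geometric simp: suminf_geometric)
    also have "\<dots> \<le> total * q\<^sup>2 * 2"
      using q_nonneg q_le total_nonneg by (intro mult_left_mono) (auto simp: divide_simps)
    ultimately show ?thesis by simp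
  qed
  have decomp: "B.series ?c = (\<lambda>x. (B.layer ?c 0 x + B.layer ?c 1 x) + R x)"
    by (simp add: R_def)
  have le_01: "\<bar>B.layer ?c 0 x + B.layer ?c 1 x\<bar> \<le> total * q ^ 0 + total * q ^ 1" for x
    using layer_le[of 0 x] layer_le[of 1 x] by linarith
  have "scalar_heat 1 (B.series ?c) x = scalar_heat 1 (\<lambda>x. B.layer ?c 0 x + B.layer ?c 1 x) x + scalar_heat 1 R x"
    unfolding decomp
    by (rule scalar_heat_add[OF zero_less_one continuous_on_add[OF layer_cont layer_cont] le_01 R_cont R_le])
  then have heat_eq: "scalar_heat 1 (B.series ?c) x = scalar_heat 1 (B.layer ?c 0) x + scalar_heat 1 (B.layer ?c 1) x + scalar_heat 1 R x"
    unfolding scalar_heat_add[OF zero_less_one layer_cont layer_le layer_cont layer_le] .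
  have h: "scalar_heat 1 (B.layer ?c j) x = Re (\<Sum>w\<in>words j. (exp (- 1 * (norm (wvec w))\<^sup>2) * ?c w) * cis (wvec w \<bullet> x))" for j
    unfolding B.layer_def[abs_def] by (subst scalar_heat_wave) (simp_all add: exp_of_real)
  have heat_0: "\<bar>scalar_heat 1 (B.layer ?c 0) x\<bar> \<le> profile 1"
    unfolding h by (rule order_trans[OF abs_Re_cis_sum_le])
      (use heated_words_0_le[OF T, of 1] in \<open>simp add: norm_mult\<close>)
  have heat_R: "\<bar>scalar_heat 1 R x\<bar> \<le> 2 * (total * q\<^sup>2)"
    by (rule abs_scalar_heat_le[OF _ R_cont R_le]) simp
  have L1: "real_of_int L \<noteq> 0" using L by simp
  \<comment> \<open>For resonant words
    \<open>Re (- \<i> * cis (x $ 2)) = sin (x $ 2) \<ge> 1 / 2\<close>. The error is subtracted from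
    them too, so that one bound can be summed over all words.\<close>
  have term_ge: "Re ((exp (- 1 * (norm (wvec w))\<^sup>2) * ?c w) * cis (wvec w \<bullet> x)) \<ge>
      (if sum_list w = 0 then exp (- 1) / 2 * modulus w T else 0) - exp (- (real_of_int L)\<^sup>2) * modulus w T" if w: "w \<in> words 1" for w
  proof (cases "sum_list w = 0")
    case True
    have "?c w = - \<i> * of_real (modulus w T)" using w by (simp add: coeff_def words_def)
    moreover have "wvec w \<bullet> x = x $ 2" using True by (simp add: wvec_def inner_axis' inner_add_left)
    ultimately have eq: "Re ((exp (- 1 * (norm (wvec w))\<^sup>2) * ?c w) * cis (wvec w \<bullet> x)) = exp (- 1) * modulus w T * sin (x $ 2)"
      unfolding norm_wvec_sq True by simp
    have "exp (- 1) * modulus w T * (1 / 2) \<le> exp (- 1) * modulus w T * sin (x $ 2)"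
      using x modulus_nonneg[OF T] by (intro mult_left_mono) auto
    moreover have "exp (- (real_of_int L)\<^sup>2) * modulus w T \<ge> 0" using modulus_nonneg[OF T] by simp
    moreover have "(if sum_list w = 0 then exp (- 1) / 2 * modulus w T else 0) = exp (- 1) * modulus w T * (1 / 2)"
      using True by simp
    ultimately show ?thesis unfolding eq by linarith
  next
    case False
    have "set w \<subseteq> \<Lambda>" using w by (simp add: words_def)
    then have "L dvd sum_list w" by (induction w) (auto simp: dvd)
    then have "\<bar>L\<bar> \<le> \<bar>sum_list w\<bar>" using False by (rule dvd_imp_le_int[rotated])
    then have "(real_of_int L)\<^sup>2 \<le> (real_of_int (sum_list w))\<^sup>2"
      unfolding abs_le_square_iff[symmetric] by linarith
    then have "exp (- 1 * (norm (wvec w))\<^sup>2) * modulus w T \<le> exp (- (real_of_int L)\<^sup>2) * modulus w T"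
      unfolding norm_wvec_sq using modulus_nonneg[OF T] by (intro mult_right_mono) auto
    moreover have "\<bar>Re ((exp (- 1 * (norm (wvec w))\<^sup>2) * ?c w) * cis (wvec w \<bullet> x))\<bar> \<le> exp (- 1 * (norm (wvec w))\<^sup>2) * modulus w T"
      by (rule order_trans[OF abs_Re_le_cmod]) (simp add: norm_mult norm_coeff[OF T])
    ultimately show ?thesis using False by simp
  qed
  \<comment> \<open>\<open>48 = 3 * 8 * 2\<close>, from \<open>exp (- T) \<ge> 1 / 3\<close> and
    \<open>1 - exp (- 2 * \<kappa>\<^sup>2 * T) \<ge> 1 / 2\<close>. Together with
    \<open>exp (- 1) / 2 \<ge> 1 / 6\<close> this gives the constant 288.\<close>
  have pair_ge: "modulus [\<kappa>, - \<kappa>] T \<ge> \<epsilon>\<^sup>2 / 48" if \<kappa>: "\<kappa> \<in> \<Lambda>" for \<kappa>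
  proof -
    have "\<bar>L\<bar> \<le> \<bar>\<kappa>\<bar>"
      using dvd[OF \<kappa>] \<kappa> zero_freqs by (intro dvd_imp_le_int) auto
    then have "(real_of_int L)\<^sup>2 \<le> (real_of_int \<kappa>)\<^sup>2"
      unfolding abs_le_square_iff[symmetric] by linarith
    then have "1 \<le> (real_of_int \<kappa>)\<^sup>2 * T"
      using LT T_pos by (meson mult_right_mono order_trans less_imp_le)
    then have "exp (- 2 * (real_of_int \<kappa>)\<^sup>2 * T) \<le> exp (- 1)" by simp
    moreover have e1: "exp (- 1) \<ge> (1 / 3 :: real)" "exp (- 1) \<le> (1 / 2 :: real)"
      using e_less_272 exp_ge_add_one_self[of 1] by (auto simp: exp_minus field_simps)
    ultimately have "1 - exp (- 2 * (real_of_int \<kappa>)\<^sup>2 * T) \<ge> 1 / 2" by linarith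
    moreover have "exp (- T) \<ge> 1 / 3"
      using T1 e1(1) by (intro order_trans[OF e1(1)]) simp
    ultimately have "1 / 3 * (\<epsilon>\<^sup>2 / 8 * (1 / 2)) \<le> modulus [\<kappa>, - \<kappa>] T"
      unfolding modulus_resonant_pair[OF \<kappa>] by (intro mult_mono) auto
    then show ?thesis by simp
  qed
  have "card \<Lambda> * \<epsilon>\<^sup>2 / 288 = (\<Sum>\<kappa>\<in>\<Lambda>. 1 / 6 * (\<epsilon>\<^sup>2 / 48))" by simp
  also have "\<dots> \<le> (\<Sum>\<kappa>\<in>\<Lambda>. exp (- 1) / 2 * modulus [\<kappa>, - \<kappa>] T)"
    using e_less_272 by (intro sum_mono mult_mono pair_ge) (auto simp: exp_minus field_simps)
  \<comment> \<open>Each \<open>\<kappa>\<close> has exactly one resonant partner,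
    \<open>- \<kappa>\<close>.\<close>
  also have "\<dots> = (\<Sum>w\<in>words 1. if sum_list w = 0 then exp (- 1) / 2 * modulus w T else 0)"
  proof -
    have "(\<Sum>\<kappa>'\<in>\<Lambda>. if \<kappa> + \<kappa>' = 0 then exp (- 1) / 2 * modulus [\<kappa>, \<kappa>'] T else 0) = exp (- 1) / 2 * modulus [\<kappa>, - \<kappa>] T"
      if "\<kappa> \<in> \<Lambda>" for \<kappa>
    proof -
      have "(\<Sum>\<kappa>'\<in>\<Lambda>. if \<kappa> + \<kappa>' = 0 then exp (- 1) / 2 * modulus [\<kappa>, \<kappa>'] T else 0) =
         (\<Sum>\<kappa>'\<in>\<Lambda>. if \<kappa>' = - \<kappa> then exp (- 1) / 2 * modulus [\<kappa>, \<kappa>'] T else 0)"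
        by (intro sum.cong refl if_cong) auto
      then show ?thesis using minus_freqs[OF that] finite_freqs by (simp del: modulus.simps)
    qed
    then have "(\<Sum>\<kappa>\<in>\<Lambda>. exp (- 1) / 2 * modulus [\<kappa>, - \<kappa>] T) =
        (\<Sum>\<kappa>\<in>\<Lambda>. \<Sum>\<kappa>'\<in>\<Lambda>. if \<kappa> + \<kappa>' = 0 then exp (- 1) / 2 * modulus [\<kappa>, \<kappa>'] T else 0)"
      by (intro sum.cong refl) (rule sym)
    then show ?thesis
      using sum_words_Suc[of "\<lambda>w. if sum_list w = 0 then exp (- 1) / 2 * modulus w T else 0" 0]
      by (simp only: sum_words_0 One_nat_def sum_list.Cons sum_list.Nil add_0_right)
  qed
  finally have "card \<Lambda> * \<epsilon>\<^sup>2 / 288 - exp (- (real_of_int L)\<^sup>2) * (\<Sum>w\<in>words 1. modulus w T)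
     \<le> (\<Sum>w\<in>words 1. (if sum_list w = 0 then exp (- 1) / 2 * modulus w T else 0) - exp (- (real_of_int L)\<^sup>2) * modulus w T)"
    by (simp add: sum_subtractf sum_distrib_left)
  also have "\<dots> \<le> scalar_heat 1 (B.layer ?c 1) x"
    unfolding h Re_sum by (intro sum_mono term_ge)
  finally have heat_1: "card \<Lambda> * \<epsilon>\<^sup>2 / 288 - exp (- (real_of_int L)\<^sup>2) * (\<Sum>w\<in>words 1. modulus w T) \<le> scalar_heat 1 (B.layer ?c 1) x" .
  have "exp (- (real_of_int L)\<^sup>2) * (\<Sum>w\<in>words 1. modulus w T) \<le> exp (- (real_of_int L)\<^sup>2) * (total * q)"
    using sum_modulus_le[OF T, of 1] by (intro mult_left_mono) auto
  with heat_eq heat_0 heat_R heat_1 show ?thesis by linarith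
qed

text \<open>It suffices to test the supremum at heat time 1. The strict inequality for the sine cuts
  out the open set, which contains a point with second coordinate \<open>pi / 2\<close>.\<close>

lemma besov_hom_norm_magnetic_ge:
  assumes ge: "\<And>x. sin (x $ 2) \<ge> 1 / 2 \<Longrightarrow> c \<le> scalar_heat 1 (B.series (\<lambda>w. coeff w T)) x"
  shows "ennreal c \<le> besov_hom_norm (magnetic T)"
proof -
  have "ennreal c \<le> Linf_norm (heat 1 (\<lambda>x. B.series (\<lambda>w. coeff w T) x *\<^sub>R axis 3 1))"
  proof (rule Linf_norm_heat_ge)
    show "open {x :: real ^ 3. sin (x $ 2) > 1 / 2}"
      by (intro open_Collect_less continuous_intros)
    have "axis 2 (pi / 2) \<in> {x :: real ^ 3. sin (x $ 2) > 1 / 2}" by (simp add: axis_def)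
    then show "{x :: real ^ 3. sin (x $ 2) > 1 / 2} \<noteq> {}" by blast
    show "c \<le> \<bar>scalar_heat 1 (B.series (\<lambda>w. coeff w T)) x\<bar>" if "x \<in> {x. sin (x $ 2) > 1 / 2}" for x
      using ge[of x] that by auto
  qed simp
  also have "\<dots> = ennreal (sqrt 1) * Linf_norm (heat 1 (magnetic T))"
    by (simp add: magnetic_def[abs_def])
  also have "\<dots> \<le> besov_hom_norm (magnetic T)"
    unfolding besov_hom_norm_def by (rule SUP_upper) simp
  finally show ?thesis .
qed

end

section \<open>Dyadic frequencies\<close>

definition dyadic_freqs :: "int \<Rightarrow> nat \<Rightarrow> int set" where
  "dyadic_freqs L r = (\<lambda>s. L * 2 ^ s) ` {..<r} \<union> (\<lambda>s. - (L * 2 ^ s)) ` {..<r}"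

text \<open>The positive and negative halves are disjoint, and an even summand takes equal values on
  them.\<close>

lemma sum_dyadic_freqs:
  fixes f :: "int \<Rightarrow> real"
  assumes L: "L > 0" and f: "\<And>k. f (- k) = f k"
  shows "(\<Sum>\<kappa>\<in>dyadic_freqs L r. f \<kappa>) = 2 * (\<Sum>s<r. f (L * 2 ^ s))"
proof -
  have inj: "inj_on (\<lambda>s. L * 2 ^ s) {..<r}" "inj_on (\<lambda>s. - (L * 2 ^ s)) {..<r}"
    using L by (auto simp: inj_on_def)
  have "(\<lambda>s. L * 2 ^ s) ` {..<r} \<inter> (\<lambda>s. - (L * 2 ^ s)) ` {..<r} = {}"
  proof (rule ccontr)
    assume "\<not> ?thesis"
    then obtain s s' where "L * 2 ^ s = - (L * 2 ^ s')" by blast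
    moreover have "L * 2 ^ s > 0" "L * 2 ^ s' > 0" using L by auto
    ultimately show False by linarith
  qed
  then have "(\<Sum>\<kappa>\<in>dyadic_freqs L r. f \<kappa>) = (\<Sum>\<kappa>\<in>(\<lambda>s. L * 2 ^ s) ` {..<r}. f \<kappa>) + (\<Sum>\<kappa>\<in>(\<lambda>s. - (L * 2 ^ s)) ` {..<r}. f \<kappa>)"
    unfolding dyadic_freqs_def by (intro sum.union_disjoint) auto
  then show ?thesis
    by (simp add: sum.reindex inj f)
qed

lemma card_dyadic_freqs: "L > 0 \<Longrightarrow> real (card (dyadic_freqs L r)) = 2 * real r"
  using sum_dyadic_freqs[of L "\<lambda>_. 1" r] by simp

section \<open>Choice of parameters\<close>

lemma norm_inflation:
  fixes d :: real
  assumes d: "0 < d" "d \<le> 1"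
  shows "\<exists>T u b p. 0 < T \<and> T < d \<and> mhd_solution T u b p \<and> smooth (u 0) \<and> smooth (b 0) \<and>
    (\<forall>t\<ge>0. besov_hom_norm (u t) \<le> ennreal (5 * d)) \<and> besov_hom_norm (b 0) \<le> ennreal (5 * d) \<and>
    ennreal (1 / d) \<le> besov_hom_norm (b T)"
proof -
  \<comment> \<open>Large enough that the \<open>2 * r\<close> resonant pairs contribute
    \<open>2 * r * d\<^sup>2 / 288 \<ge> 8 / d\<close>.\<close>
  define r where "r = nat \<lceil>1152 / d ^ 3\<rceil>"
  \<comment> \<open>The factor 16 yields \<open>q \<le> 1 / 16\<close>; the power
    \<open>8 ^ r\<close> makes \<open>total * q\<^sup>2\<close>, of size at most
    \<open>8 ^ r / L\<close>, small.\<close>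
  define L :: int where "L = 16 * 8 ^ r"
  \<comment> \<open>The time scale on which the lowest frequency dissipates, so
    \<open>\<kappa>\<^sup>2 * T \<ge> 1\<close> for all frequencies.\<close>
  define T where "T = 1 / (real_of_int L)\<^sup>2"
  define q where "q = d * real r / real_of_int L"
  have r_ge: "real r \<ge> 1152 / d ^ 3" unfolding r_def using d by linarith
  have r2: "real r \<le> 2 ^ r" using less_imp_le[OF less_exp[of r]] by (metis of_nat_le_iff of_nat_numeral of_nat_power)
  have L_eq: "real_of_int L = 16 * 8 ^ r" by (simp add: L_def)
  have eight: "(8::real) ^ r = 2 ^ r * (2 ^ r * 2 ^ r)" by (simp flip: power_mult_distrib)
  have p1: "(2::real) ^ r \<ge> 1" by simp
  have L_ge: "real_of_int L \<ge> 16 * 2 ^ r" "real_of_int L \<ge> 2 ^ r * 2 ^ r" "real_of_int L \<ge> 1"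
  proof -
    have "(2::real) ^ r \<le> 8 ^ r" "(4::real) ^ r \<le> 8 ^ r" "(1::real) \<le> 8 ^ r" by (auto intro: power_mono)
    moreover have "(2::real) ^ r * 2 ^ r = 4 ^ r" by (simp flip: power_mult_distrib)
    ultimately show "real_of_int L \<ge> 16 * 2 ^ r" "real_of_int L \<ge> 2 ^ r * 2 ^ r" "real_of_int L \<ge> 1"
      unfolding L_eq by linarith+
  qed
  have L0: "L > 0" using L_ge(3) by linarith
  let ?\<Lambda> = "dyadic_freqs L r"
  interpret resonant_waves ?\<Lambda> d T q
  proof
    show "finite ?\<Lambda>" by (simp add: dyadic_freqs_def)
    show "- \<kappa> \<in> ?\<Lambda>" if "\<kappa> \<in> ?\<Lambda>" for \<kappa> using that by (auto simp: dyadic_freqs_def)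
    show "0 \<notin> ?\<Lambda>" using L0 by (auto simp: dyadic_freqs_def)
    show "0 < T" using L0 by (simp add: T_def)
    have "(\<Sum>\<kappa>\<in>?\<Lambda>. d / (2 * \<bar>real_of_int \<kappa>\<bar>)) = (\<Sum>s<r. d / (real_of_int L * 2 ^ s))"
      using L0 by (subst sum_dyadic_freqs) (auto simp: sum_distrib_left abs_mult)
    also have "\<dots> \<le> (\<Sum>s<r. d / real_of_int L)"
      using d L0 by (intro sum_mono divide_left_mono) auto
    finally show "(\<Sum>\<kappa>\<in>?\<Lambda>. d / (2 * \<bar>real_of_int \<kappa>\<bar>)) \<le> q" by (simp add: q_def mult.commute)
    have "d * real r \<le> 1 * 2 ^ r" using d r2 by (intro mult_mono) auto
    then show "q \<le> 1 / 16" using L_ge(1) L0 by (simp add: q_def divide_simps)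
  qed (use d in auto)
  \<comment> \<open>Rescaling by \<open>y = sqrt \<tau> * L\<close> reduces the claim to
    \<open>lacunary_sum_le\<close>, whose bound 5 is uniform in \<open>r\<close>.\<close>
  have profile: "sqrt \<tau> * profile \<tau> \<le> 5 * d" if \<tau>: "\<tau> > 0" for \<tau>
  proof -
    define y where "y = sqrt \<tau> * real_of_int L"
    have y: "y \<ge> 0" using \<tau> L0 by (simp add: y_def)
    have y2: "(y * 2 ^ s)\<^sup>2 = \<tau> * (real_of_int L * 2 ^ s)\<^sup>2" for s
      using \<tau> by (simp add: y_def power_mult_distrib)
    have "profile \<tau> = (\<Sum>s<r. d * (real_of_int L * 2 ^ s) * exp (- (y * 2 ^ s)\<^sup>2))"
      unfolding profile_def using L0 by (subst sum_dyadic_freqs) (auto simp: sum_distrib_left abs_mult y2)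
    then have "sqrt \<tau> * profile \<tau> = d * (\<Sum>s<r. y * 2 ^ s * exp (- (y * 2 ^ s)\<^sup>2))"
      by (simp add: sum_distrib_left y_def mult_ac)
    also have "\<dots> \<le> d * 5" using d lacunary_sum_le[OF y] by (intro mult_left_mono) auto
    finally show ?thesis by simp
  qed
  have total_le: "total \<le> d * real_of_int L * 2 ^ r"
  proof -
    have "total = (\<Sum>s<r. d * (real_of_int L * 2 ^ s))"
      using L0 by (subst sum_dyadic_freqs) (auto simp: sum_distrib_left abs_mult)
    also have "\<dots> = d * real_of_int L * (\<Sum>s<r. 2 ^ s)" by (simp add: sum_distrib_left mult_ac)
    also have "(\<Sum>s<r. (2::real) ^ s) \<le> 2 ^ r" by (simp add: geometric_sum)
    finally show ?thesis using d L0 by (simp add: mult_left_mono)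
  qed
  \<comment> \<open>The powers of \<open>L\<close> in \<open>total\<close> and \<open>q\<close>
    cancel here, so smallness of the later iterates must come from the second factor
    \<open>q\<close>.\<close>
  have total_q: "total * q \<le> 2 ^ r * 2 ^ r"
  proof -
    have "total * q \<le> d * real_of_int L * 2 ^ r * q"
      using total_le q_nonneg by (rule mult_right_mono)
    also have "\<dots> = d\<^sup>2 * (2 ^ r * real r)" using L0 by (simp add: q_def power2_eq_square)
    also have "\<dots> \<le> 1 * (2 ^ r * 2 ^ r)"
      using d r2 by (intro mult_mono power_le_one) auto
    finally show ?thesis by simp
  qed
  \<comment> \<open>Exponential damping beats the crude bound
    \<open>total * q \<le> 4 ^ r \<le> L\<^sup>2\<close>.\<close>
  have "exp (- (real_of_int L)\<^sup>2) * (total * q) \<le> 1"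
  proof -
    have "total * q \<le> real_of_int L * real_of_int L"
      using total_q L_ge(2,3) mult_right_mono[of 1 "real_of_int L" "real_of_int L"] by linarith
    also have "\<dots> \<le> exp ((real_of_int L)\<^sup>2)"
      using exp_ge_add_one_self[of "(real_of_int L)\<^sup>2"] unfolding power2_eq_square by linarith
    finally show ?thesis by (simp add: exp_minus field_simps)
  qed
  moreover have "2 * (total * q\<^sup>2) \<le> 1"
  proof -
    have "total * q\<^sup>2 = (total * q) * q" by (simp add: power2_eq_square)
    also have "\<dots> \<le> (2 ^ r * 2 ^ r) * q" using total_q q_nonneg by (rule mult_right_mono)
    also have "q \<le> 2 ^ r / real_of_int L"
      using d r2 L0 mult_mono[of d 1 "real r" "2 ^ r"] by (simp add: q_def divide_right_mono)
    then have "(2 ^ r * 2 ^ r) * q \<le> (2 ^ r * 2 ^ r) * (2 ^ r / real_of_int L)"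
      by (intro mult_left_mono) auto
    also have "\<dots> = 1 / 16" unfolding L_eq eight by simp
    finally show ?thesis by simp
  qed
  moreover have "profile 1 \<le> 5" using profile[of 1] d by simp
  moreover have "card ?\<Lambda> * d\<^sup>2 / 288 \<ge> 8 / d"
  proof -
    have "8 / d = 2 * (1152 / d ^ 3) * d\<^sup>2 / 288" using d by (simp add: power2_eq_square power3_eq_cube)
    also have "\<dots> \<le> 2 * real r * d\<^sup>2 / 288" using r_ge by (intro divide_right_mono mult_right_mono mult_left_mono) auto
    finally show ?thesis using card_dyadic_freqs[OF L0] by simp
  qed
  \<comment> \<open>The errors add up to \<open>7 = 5 + 1 + 1\<close>, at most \<open>7 / d\<close>
    since \<open>d \<le> 1\<close>.\<close>
  moreover have "8 / d - 7 \<ge> 1 / d" using d by (simp add: field_simps)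
  ultimately have ge: "1 / d \<le> card ?\<Lambda> * d\<^sup>2 / 288 - profile 1 - exp (- (real_of_int L)\<^sup>2) * (total * q) - 2 * (total * q\<^sup>2)"
    by linarith
  have T1: "T \<le> 1" using L_ge(3) by (simp add: T_def)
  have "ennreal (1 / d) \<le> besov_hom_norm (magnetic T)"
  proof (rule besov_hom_norm_magnetic_ge)
    fix x :: "real ^ 3" assume "sin (x $ 2) \<ge> 1 / 2"
    moreover have "L dvd \<kappa>" if "\<kappa> \<in> ?\<Lambda>" for \<kappa> using that by (auto simp: dyadic_freqs_def)
    moreover have "(real_of_int L)\<^sup>2 * T \<ge> 1" using L0 by (simp add: T_def)
    ultimately show "1 / d \<le> scalar_heat 1 (B.series (\<lambda>w. coeff w T)) x"
      using scalar_heat_magnetic_ge[OF _ L0 _ T1] ge by (meson order_trans)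
  qed
  moreover have "T < d"
  proof -
    have "1 / d \<le> 1152 / d ^ 3"
      using d mult_mono[of d 1 d 1] by (simp add: divide_simps power3_eq_cube)
    also have "\<dots> < real_of_int L"
      using r_ge r2 L_ge(1) p1 by linarith
    finally have "1 / real_of_int L < d" using d L0 by (simp add: field_simps)
    moreover have "T \<le> 1 / real_of_int L"
      using L_ge(3) by (simp add: T_def power2_eq_square divide_simps)
    ultimately show ?thesis by linarith
  qed
  ultimately show ?thesis
    using T_pos mhd_solution_waves smooth_initial besov_hom_norm_vel_le[OF profile] besov_hom_norm_magnetic_0_le[OF profile]
    by blast
qed

theorem theorem1p1:
  shows "\<exists>C::real. C > 0 \<and> (\<forall>\<delta>::real. \<delta> > 0 \<longrightarrow>
    (\<exists>(u0 :: real ^ 3 \<Rightarrow> real ^ 3) (b0 :: real ^ 3 \<Rightarrow> real ^ 3) (T :: real)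
       (u :: real \<Rightarrow> real ^ 3 \<Rightarrow> real ^ 3) (b :: real \<Rightarrow> real ^ 3 \<Rightarrow> real ^ 3)
       (p :: real \<Rightarrow> real ^ 3 \<Rightarrow> real).
       periodic u0 \<and> smooth u0 \<and> (\<forall>x. divergence u0 x = 0) \<and>
       periodic b0 \<and> smooth b0 \<and> (\<forall>x. divergence b0 x = 0) \<and>
       0 < T \<and> T < \<delta> \<and>
       mhd_solution T u b p \<and> u 0 = u0 \<and> b 0 = b0 \<and>
       besov_hom_norm (u 0) \<le> ennreal (C * \<delta>) \<and>
       besov_hom_norm (b 0) \<le> ennreal (C * \<delta>) \<and>
       ennreal (1 / \<delta>) \<le> ennreal C * besov_hom_norm (b T) \<and>
       (\<forall>t. 0 < t \<and> t < T \<longrightarrow> besov_norm (u t) \<le> ennreal (C * \<delta>))))"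
proof (rule exI[of _ 5], intro conjI allI impI)
  fix \<delta> :: real assume \<delta>: "\<delta> > 0"
  \<comment> \<open>For \<open>\<delta> > 1\<close> the construction with \<open>d = 1\<close>
    already satisfies the bounds. The constant 5 is the one of the lacunary sum.\<close>
  define d where "d = min \<delta> 1"
  have d: "0 < d" "d \<le> 1" "d \<le> \<delta>" using \<delta> by (auto simp: d_def)
  obtain T u b p where T: "0 < T" "T < d" and sol: "mhd_solution T u b p" and smooth: "smooth (u 0)" "smooth (b 0)"
    and u: "\<And>t. t \<ge> 0 \<Longrightarrow> besov_hom_norm (u t) \<le> ennreal (5 * d)"
    and b0: "besov_hom_norm (b 0) \<le> ennreal (5 * d)" and bT: "ennreal (1 / d) \<le> besov_hom_norm (b T)"
    using norm_inflation[OF d(1,2)] by blast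
  have le: "ennreal (5 * d) \<le> ennreal (5 * \<delta>)" using d by (intro ennreal_leI) simp
  have "periodic (u 0)" "periodic (b 0)" "\<forall>x. divergence (u 0) x = 0" "\<forall>x. divergence (b 0) x = 0"
    using sol T unfolding mhd_solution_def classical_field_def by auto
  moreover have "T < \<delta>" using T d by linarith
  moreover have "besov_hom_norm (u 0) \<le> ennreal (5 * \<delta>)" "besov_hom_norm (b 0) \<le> ennreal (5 * \<delta>)"
    using u[of 0] b0 le by (auto intro: order_trans)
  moreover have "ennreal (1 / \<delta>) \<le> ennreal 5 * besov_hom_norm (b T)"
  proof -
    have "ennreal (1 / \<delta>) \<le> ennreal (1 / d)" using d \<delta> by (intro ennreal_leI divide_left_mono) auto
    also have "\<dots> \<le> 1 * besov_hom_norm (b T)" using bT by simp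
    also have "\<dots> \<le> ennreal 5 * besov_hom_norm (b T)" by (intro mult_right_mono) auto
    finally show ?thesis .
  qed
  moreover have "besov_norm (u t) \<le> ennreal (5 * \<delta>)" if "0 < t \<and> t < T" for t
    using order_trans[OF besov_norm_le_besov_hom_norm u[of t]] that le by (auto intro: order_trans)
  ultimately show "\<exists>u0 b0 T u b p. periodic u0 \<and> smooth u0 \<and> (\<forall>x. divergence u0 x = 0) \<and>
       periodic b0 \<and> smooth b0 \<and> (\<forall>x. divergence b0 x = 0) \<and>
       0 < T \<and> T < \<delta> \<and>
       mhd_solution T u b p \<and> u 0 = u0 \<and> b 0 = b0 \<and>
       besov_hom_norm (u 0) \<le> ennreal (5 * \<delta>) \<and>
       besov_hom_norm (b 0) \<le> ennreal (5 * \<delta>) \<and>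
       ennreal (1 / \<delta>) \<le> ennreal 5 * besov_hom_norm (b T) \<and>
       (\<forall>t. 0 < t \<and> t < T \<longrightarrow> besov_norm (u t) \<le> ennreal (5 * \<delta>))"
    using T sol smooth by blast
qed simp

end
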